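(* Let $K/\mathbb{Q}$ be a finite Galois extension of degree $n$ with Galois group $G$, and let $h \mid n$ be a possible residue degree in $K/\mathbb{Q}$ (i.e. $G$ has a cyclic subgroup of order $h$). Let $\mu(K)$ be the group of roots of unity of $K$. Let $\eta \in K^\times$ be such that the multiplicative $\mathbb{Z}[G]$-module generated by $\eta$ (the subgroup of $K^\times$ generated by the conjugates $\eta^\sigma$, $\sigma\in G$) has $\mathbb{Z}$-rank $n$. Then for all sufficiently large prime numbers $p$, unramified in $K/\mathbb{Q}$, prime to $\eta$, with residue degree $n_p = h$, and for every prime ideal $\mathfrak p \mid p$ of $K$, the least integer $k \geq 1$ for which there exists $\zeta \in \mu(K)$ with $\eta^k \equiv \zeta \pmod{\mathfrak p}$ is a divisor of $p^h - 1$ which does not divide any of the integers $$D_{h,\delta}(p) := \frac{p^h - 1}{\Phi_\delta(p)}, \qquad \delta \mid h,$$ where $\Phi_\delta(X)$ is the $\delta$-th cyclotomic polynomial. Consequently, $o_{\mathfrak p}(\eta)$ and $o_p(\eta)$ do not divide any of the $D_{h,\delta}(p)$, $\delta\mid h$.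
   Context: For a prime $p$ unramified in $K/\mathbb{Q}$ and prime to $\eta$, and a prime ideal $\mathfrak p\mid p$, the order $o_{\mathfrak p}(\eta)$ is the least integer $k\ge 1$ with $\eta^k\equiv 1 \pmod{\mathfrak p}$, and the order $o_p(\eta)$ is the least integer $k \ge 1$ with $\eta^k \equiv 1 \pmod{p}$ (congruences taken in the ring of $p$-integral elements of $K$). The residue degree $n_p$ of $p$ is the common residue degree $[Z_K/\mathfrak p:\mathbb{F}_p]$ of the primes $\mathfrak p\mid p$. *)

theory Defs
  imports
    Complex_Main
    "HOL-Computational_Algebra.Computational_Algebra"
    "HOL-Algebra.Ideal_Product"
    "HOL-Algebra.QuotRing"
    "HOL-Algebra.Embedded_Algebras"
    "HOL-Algebra.Elementary_Groups"
begin

text \<open>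
  The field \<open>K\<close> is the whole type \<open>'a :: field_char_0\<close>; its prime field is \<open>range of_rat\<close>.
  Rings attached to \<open>K\<close> are records with the operations inherited from \<open>'a\<close>.
\<close>

definition rat_scale :: "rat \<Rightarrow> 'a \<Rightarrow> 'a::field_char_0" where
  "rat_scale q x = of_rat q * x"

global_interpretation rat_vs: vector_space "rat_scale :: rat \<Rightarrow> 'a \<Rightarrow> 'a::field_char_0"
  by unfold_locales (simp_all add: rat_scale_def algebra_simps of_rat_add of_rat_mult)

definition galois_group :: "('a::field_char_0 \<Rightarrow> 'a) monoid" where
  "galois_group =
     \<lparr>carrier = {\<sigma>. bij \<sigma> \<and> (\<forall>x y. \<sigma> (x + y) = \<sigma> x + \<sigma> y) \<and> (\<forall>x y. \<sigma> (x * y) = \<sigma> x * \<sigma> y)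
                 \<and> (\<forall>q. \<sigma> (of_rat q) = of_rat q)},
      monoid.mult = (\<circ>), one = id\<rparr>"

definition finite_galois_over_rat :: "'a::field_char_0 itself \<Rightarrow> bool" where
  "finite_galois_over_rat _ \<longleftrightarrow>
     (\<exists>B :: 'a set. finite B \<and> rat_vs.span B = UNIV) \<and>
     {x :: 'a. \<forall>\<sigma>\<in>carrier galois_group. \<sigma> x = x} = range of_rat"

definition degree_over_rat :: "'a::field_char_0 itself \<Rightarrow> nat" where
  "degree_over_rat _ = rat_vs.dim (UNIV :: 'a set)"

definition ring_of_integers :: "'a::field_char_0 ring" where
  "ring_of_integers =
     \<lparr>carrier = {x. algebraic_int x}, monoid.mult = (*), one = 1, zero = 0, add = (+)\<rparr>"

definition primes_above :: "nat \<Rightarrow> 'a::field_char_0 set set" where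
  "primes_above p = {P. primeideal P ring_of_integers \<and> of_nat p \<in> P}"

text \<open>The \<open>\<int>\<close>-multiples of \<open>1\<close> in the residue ring of \<open>P\<close> are the copy of \<open>\<int>/p\<close> in it.\<close>

definition residue_degree :: "'a::field_char_0 set \<Rightarrow> nat" where
  "residue_degree P =
     ring.dim (ring_of_integers Quot P)
       (range (\<lambda>m::int. P +>\<^bsub>ring_of_integers\<^esub> of_int m))
       (carrier (ring_of_integers Quot P))"

definition has_residue_degree :: "'a::field_char_0 itself \<Rightarrow> nat \<Rightarrow> nat \<Rightarrow> bool" where
  "has_residue_degree _ p f \<longleftrightarrow> (\<forall>P \<in> (primes_above p :: 'a set set). residue_degree P = f)"

definition ramification_index :: "nat \<Rightarrow> 'a::field_char_0 set \<Rightarrow> nat" where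
  "ramification_index p P =
     (GREATEST e. PIdl\<^bsub>ring_of_integers\<^esub> (of_nat p) \<subseteq> P [^]\<^bsub>ideals_set ring_of_integers\<^esub> e)"

definition unramified :: "'a::field_char_0 itself \<Rightarrow> nat \<Rightarrow> bool" where
  "unramified _ p \<longleftrightarrow> (\<forall>P \<in> (primes_above p :: 'a set set). ramification_index p P = 1)"

text \<open>\<open>x\<close> has valuation \<open>0\<close> at every prime ideal above \<open>p\<close>.\<close>

definition prime_to :: "nat \<Rightarrow> 'a::field_char_0 \<Rightarrow> bool" where
  "prime_to p x \<longleftrightarrow>
     (\<forall>P \<in> primes_above p. \<exists>a \<in> carrier ring_of_integers - P. \<exists>b \<in> carrier ring_of_integers - P.
        x = a / b)"

text \<open>
  The ring of \<open>p\<close>-integral elements: the localisation of the ring of integers at the integers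
  prime to \<open>p\<close>, which is the integral closure of \<open>\<int>\<close> localised at \<open>p\<close>.
\<close>

definition p_integers :: "nat \<Rightarrow> 'a::field_char_0 ring" where
  "p_integers p =
     \<lparr>carrier = {a / of_int m | a m. a \<in> carrier ring_of_integers \<and> \<not> int p dvd m},
      monoid.mult = (*), one = 1, zero = 0, add = (+)\<rparr>"

text \<open>
  Congruence of \<open>p\<close>-integral elements modulo the ideal generated by \<open>S\<close>; it is used with \<open>S\<close> a
  prime ideal above \<open>p\<close> and with \<open>S = {p}\<close>.
\<close>

definition p_cong :: "nat \<Rightarrow> 'a::field_char_0 set \<Rightarrow> 'a \<Rightarrow> 'a \<Rightarrow> bool" where
  "p_cong p S x y \<longleftrightarrow>
     x \<in> carrier (p_integers p) \<and> y \<in> carrier (p_integers p) \<and> x - y \<in> Idl\<^bsub>p_integers p\<^esub> S"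

definition roots_of_unity :: "'a::field_char_0 set" where
  "roots_of_unity = {\<zeta>. \<exists>m::nat. m > 0 \<and> \<zeta> ^ m = 1}"

definition order_mod_prime :: "nat \<Rightarrow> 'a::field_char_0 set \<Rightarrow> 'a \<Rightarrow> nat" where
  "order_mod_prime p P x = (LEAST k. k \<ge> 1 \<and> p_cong p P (x ^ k) 1)"

definition order_mod_p :: "nat \<Rightarrow> 'a::field_char_0 \<Rightarrow> nat" where
  "order_mod_p p x = (LEAST k. k \<ge> 1 \<and> p_cong p {of_nat p} (x ^ k) 1)"

definition order_mod_prime_roots :: "nat \<Rightarrow> 'a::field_char_0 set \<Rightarrow> 'a \<Rightarrow> nat" where
  "order_mod_prime_roots p P x =
     (LEAST k. k \<ge> 1 \<and> (\<exists>\<zeta> \<in> roots_of_unity. p_cong p P (x ^ k) \<zeta>))"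

definition mult_group :: "'a::field_char_0 monoid" where
  "mult_group = \<lparr>carrier = UNIV - {0}, monoid.mult = (*), one = 1\<rparr>"

definition galois_module :: "'a::field_char_0 \<Rightarrow> 'a set" where
  "galois_module x = generate mult_group ((\<lambda>\<sigma>. \<sigma> x) ` carrier galois_group)"

definition mult_independent :: "'a::field_char_0 set \<Rightarrow> bool" where
  "mult_independent S \<longleftrightarrow>
     finite S \<and> (\<forall>e :: 'a \<Rightarrow> int. (\<Prod>x\<in>S. x powi e x) = 1 \<longrightarrow> (\<forall>x\<in>S. e x = 0))"

text \<open>The \<open>\<int>\<close>-rank of a multiplicative subgroup: the maximal size of an independent subset.\<close>

definition has_mult_rank :: "'a::field_char_0 set \<Rightarrow> nat \<Rightarrow> bool" where
  "has_mult_rank M r \<longleftrightarrow>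
     (\<exists>S \<subseteq> M. mult_independent S \<and> card S = r) \<and>
     (\<forall>S \<subseteq> M. mult_independent S \<longrightarrow> card S \<le> r)"

definition primitive_roots_of_unity :: "nat \<Rightarrow> complex set" where
  "primitive_roots_of_unity d = {\<omega>. \<omega> ^ d = 1 \<and> (\<forall>k. 0 < k \<and> k < d \<longrightarrow> \<omega> ^ k \<noteq> 1)}"

text \<open>For \<open>d \<ge> 1\<close> the product below has integer coefficients.\<close>

definition cyclotomic_poly :: "nat \<Rightarrow> int poly" where
  "cyclotomic_poly d =
     (THE q. map_poly of_int q = (\<Prod>\<omega>\<in>primitive_roots_of_unity d. [:- \<omega>, 1:]))"

text \<open>For \<open>\<delta> dvd h\<close> and \<open>h \<ge> 1\<close> the division is exact.\<close>

definition D_quot :: "nat \<Rightarrow> nat \<Rightarrow> nat \<Rightarrow> int" where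
  "D_quot h \<delta> p = (int p ^ h - 1) div poly (cyclotomic_poly \<delta>) (int p)"

end

theory Submission
  imports Defs "HOL-Number_Theory.Residues"
begin

text \<open>
  The rank hypothesis makes the conjugates of \<open>\<eta>\<close> multiplicatively independent; in particular they
  are pairwise distinct, so \<open>\<eta>\<close> is a primitive element. For large \<open>p\<close> a Frobenius element \<open>\<sigma>\<close> at \<open>P\<close>
  comes from the congruence \<open>f (\<eta> ^ p) = f \<eta> ^ p = 0\<close> for \<open>f = (\<Prod>\<tau>. X - \<tau> \<eta>)\<close>, and counting the roots of
  \<open>X ^ p ^ m - X\<close> in the residue field shows that \<open>\<sigma>\<close> has order at least \<open>h\<close>. Let
  \<open>A = (X ^ h - 1) / \<Phi>\<^sub>\<delta> = (\<Sum>i<h. a\<^sub>i X ^ i)\<close>. If \<open>\<eta> ^ k = \<zeta>\<close> modulo \<open>P\<close> and \<open>k\<close> divides \<open>A p\<close>, then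
  \<open>(\<Prod>i<h. (\<sigma>\<^sup>i \<eta>) powi a\<^sub>i) = \<eta> powi A p\<close> is congruent to a root of unity modulo \<open>P\<close>, while by
  independence it is not equal to one. Since \<open>K\<close> has only finitely many roots of unity and
  automorphisms, this can happen for finitely many \<open>p\<close> only.
\<close>

hide_const (open) up_ring.coeff up_ring.monom module.smult

section \<open>Automorphisms and integral multiples\<close>

text \<open>The work takes place in the ring of p-integral elements, where for large
  \<open>p\<close> both \<eta> and \<open>diff_prod\<close>, the derivative of
  \<open>root_poly\<close> at \<eta>, are units. Up to the unit \<open>diff_prod\<close> every
  p-integral element is then a polynomial in \<eta> with rational p-integral coefficients, found by
  Lagrange interpolation at the conjugates. This fact replaces an integral basis and a decomposition
  group: it makes residues finite, and it carries the Frobenius congruence from \<eta>, where it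
  comes from a root of f, to all elements. The obstacle is that \<sigma> and the root of unity vary
  with \<open>p\<close>. All differences that may occur are therefore collected in one finite set
  depending only on \<open>h\<close> and \<eta>; each nonzero member has a p-integral inverse at
  almost all primes. Finiteness of the set rests on the roots of unity of K, which are counted
  through their residues at one auxiliary prime.\<close>

abbreviation Gal :: "('a::field_char_0 \<Rightarrow> 'a) set" where
  "Gal \<equiv> carrier galois_group"

lemma GalD:
  assumes "\<sigma> \<in> Gal"
  shows "bij \<sigma>" "\<sigma> (x + y) = \<sigma> x + \<sigma> y" "\<sigma> (x * y) = \<sigma> x * \<sigma> y" "\<sigma> (of_rat q) = of_rat q"
  using assms by (auto simp: galois_group_def)

lemma Gal_of_int: "\<sigma> \<in> Gal \<Longrightarrow> \<sigma> (of_int k) = of_int k"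
  using GalD(4)[of \<sigma> "of_int k"] by simp

lemma Gal_simps:
  assumes "\<sigma> \<in> Gal"
  shows "\<sigma> 0 = 0" "\<sigma> 1 = 1" "\<sigma> (x + y) = \<sigma> x + \<sigma> y" "\<sigma> (x * y) = \<sigma> x * \<sigma> y"
    "\<sigma> (- x) = - \<sigma> x" "\<sigma> (x - y) = \<sigma> x - \<sigma> y" "\<sigma> (x ^ k) = \<sigma> x ^ k" "\<sigma> x = 0 \<longleftrightarrow> x = 0"
    "\<sigma> (inverse x) = inverse (\<sigma> x)" "\<sigma> (x / y) = \<sigma> x / \<sigma> y" "\<sigma> x = \<sigma> y \<longleftrightarrow> x = y"
proof -
  note D = GalD[OF assms]
  show 0: "\<sigma> 0 = 0" and 1: "\<sigma> 1 = 1" using D(4)[of 0] D(4)[of 1] by simp_all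
  show "\<sigma> (x + y) = \<sigma> x + \<sigma> y" and mult: "\<sigma> (x * y) = \<sigma> x * \<sigma> y" for x y by (fact D)+
  show minus: "\<sigma> (- x) = - \<sigma> x" for x
    using D(2)[of x "- x"] 0 by (simp add: eq_neg_iff_add_eq_0 add.commute)
  show "\<sigma> (x - y) = \<sigma> x - \<sigma> y" using D(2)[of x "- y"] minus[of y] by simp
  show "\<sigma> (x ^ k) = \<sigma> x ^ k" by (induction k) (simp_all add: 1 mult)
  show inj: "\<sigma> x = \<sigma> y \<longleftrightarrow> x = y" for x y using D(1) by (auto simp: bij_def inj_def)
  show "\<sigma> x = 0 \<longleftrightarrow> x = 0" for x using inj[of x 0] 0 by simp
  show inv: "\<sigma> (inverse x) = inverse (\<sigma> x)" for x
  proof (cases "x = 0")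
    case False
    then have "\<sigma> x * \<sigma> (inverse x) = 1" using mult[of x "inverse x"] 1 by simp
    then show ?thesis by (metis inverse_unique)
  qed (simp add: 0)
  show "\<sigma> (x / y) = \<sigma> x / \<sigma> y" by (simp add: divide_inverse mult inv)
qed

lemma Gal_sum: "\<sigma> \<in> Gal \<Longrightarrow> \<sigma> (sum f A) = (\<Sum>x\<in>A. \<sigma> (f x))"
  by (induction A rule: infinite_finite_induct) (simp_all add: Gal_simps[of \<sigma>])

lemma Gal_id [simp]: "id \<in> Gal"
  by (simp add: galois_group_def)

lemma Gal_comp [simp]: "\<sigma> \<in> Gal \<Longrightarrow> \<tau> \<in> Gal \<Longrightarrow> \<sigma> \<circ> \<tau> \<in> Gal"
  by (auto simp: galois_group_def bij_comp)

lemma Gal_inv [simp]: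
  assumes "\<sigma> \<in> Gal"
  shows "inv_into UNIV \<sigma> \<in> Gal"
proof -
  have b: "bij \<sigma>" using assms by (rule GalD)
  then have si: "\<sigma> (inv_into UNIV \<sigma> x) = x" for x by (simp add: bij_is_surj surj_f_inv_f)
  have eqI: "u = v" if "\<sigma> u = \<sigma> v" for u v using that Gal_simps(11)[OF assms] by blast
  have "inv_into UNIV \<sigma> (x + y) = inv_into UNIV \<sigma> x + inv_into UNIV \<sigma> y"
    "inv_into UNIV \<sigma> (x * y) = inv_into UNIV \<sigma> x * inv_into UNIV \<sigma> y"
    "inv_into UNIV \<sigma> (of_rat q) = of_rat q" for x y q
    by (rule eqI, simp only: si GalD[OF assms])+
  then show ?thesis using b by (auto simp: galois_group_def bij_imp_bij_inv)
qed

lemma Gal_funpow [simp]: "\<sigma> \<in> Gal \<Longrightarrow> \<sigma> ^^ k \<in> Gal"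
  by (induction k) auto

lemma bij_betw_comp_Gal: "\<tau> \<in> Gal \<Longrightarrow> bij_betw ((\<circ>) \<tau>) Gal Gal"
proof (rule bij_betw_byWitness[where f' = "(\<circ>) (inv_into UNIV \<tau>)"])
  assume \<tau>: "\<tau> \<in> Gal"
  then have "bij \<tau>" by (rule GalD)
  then show "\<forall>a\<in>Gal. inv_into UNIV \<tau> \<circ> (\<tau> \<circ> a) = a" "\<forall>a\<in>Gal. \<tau> \<circ> (inv_into UNIV \<tau> \<circ> a) = a"
    by (auto simp: fun_eq_iff bij_is_inj bij_is_surj surj_f_inv_f)
qed auto

lemma Gal_poly: "\<sigma> \<in> Gal \<Longrightarrow> \<sigma> (poly g x) = poly (map_poly \<sigma> g) (\<sigma> x)"
  by (induction g) (simp_all add: map_poly_pCons Gal_simps[of \<sigma>])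

lemma Gal_poly_rat:
  assumes "\<sigma> \<in> Gal" "\<And>i. coeff g i \<in> \<rat>"
  shows "\<sigma> (poly g x) = poly g (\<sigma> x)"
proof -
  have "\<sigma> (coeff g i) = coeff g i" for i
    using assms(2)[of i] GalD(4)[OF assms(1)] by (auto elim!: Rats_cases)
  then have "map_poly \<sigma> g = g"
    using assms(1) by (intro poly_eqI) (simp add: coeff_map_poly Gal_simps(1))
  then show ?thesis using Gal_poly[OF assms(1)] by metis
qed

lemma map_poly_Gal_sum: "\<sigma> \<in> Gal \<Longrightarrow> map_poly \<sigma> (sum f A) = (\<Sum>x\<in>A. map_poly \<sigma> (f x))"
  by (intro poly_eqI) (simp add: coeff_map_poly coeff_sum Gal_sum Gal_simps(1))

lemma map_poly_Gal_mult: "\<sigma> \<in> Gal \<Longrightarrow> map_poly \<sigma> (f * g) = map_poly \<sigma> f * map_poly \<sigma> g"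
  by (intro poly_eqI) (simp add: coeff_map_poly coeff_mult Gal_sum Gal_simps[of \<sigma>])

lemma map_poly_Gal_prod: "\<sigma> \<in> Gal \<Longrightarrow> map_poly \<sigma> (prod f A) = (\<Prod>x\<in>A. map_poly \<sigma> (f x))"
  by (induction A rule: infinite_finite_induct) (simp_all add: map_poly_Gal_mult Gal_simps[of \<sigma>])

lemma algebraic_int_Gal:
  assumes "\<sigma> \<in> Gal" "algebraic_int x"
  shows "algebraic_int (\<sigma> x)"
proof -
  from assms(2) obtain g where g: "lead_coeff g = 1" "\<And>i. coeff g i \<in> \<int>" "poly g x = 0"
    by (auto elim: algebraic_int.cases)
  have "poly g (\<sigma> x) = \<sigma> (poly g x)"
    using g(2) by (intro Gal_poly_rat[symmetric] assms) (use Ints_subset_Rats in blast)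
  then show ?thesis using g assms(1) by (auto simp: Gal_simps(1) intro!: algebraic_int.intros)
qed

text \<open>If \<open>d\<close> is the leading coefficient of an integer polynomial of degree
  \<open>m\<close> with root \<open>x\<close>, then \<open>d ^ (m - 1)\<close> times that polynomial
  is a monic integer polynomial in \<open>d * x\<close>. This bounds the primes at which
  \<open>x\<close> has a denominator.\<close>

lemma algebraic_int_multiple:
  assumes "algebraic x"
  obtains d :: int where "d \<noteq> 0" "algebraic_int (of_int d * x)"
proof -
  from assms obtain p where p: "p \<noteq> 0" "\<And>i. coeff p i \<in> \<int>" "poly p x = 0"
    by (auto elim: algebraicE)
  define m where "m = degree p"
  have m: "m > 0"
    using p(1,3) unfolding m_def by (metis degree_eq_zeroE gr0I mult_zero_right poly_0 poly_pCons add.right_neutral pCons_0_0)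
  obtain d where d: "lead_coeff p = of_int d" using p(2) by (meson Ints_cases)
  define q where "q = monom 1 m + (\<Sum>i<m. monom (coeff p i * of_int d ^ (m - 1 - i)) i)"
  have cq: "coeff q k = (if k = m then 1 else if k < m then coeff p k * of_int d ^ (m - 1 - k) else 0)" for k
    by (auto simp: q_def coeff_sum)
  have "degree q = m" by (intro antisym degree_le le_degree) (auto simp: cq)
  then have lead: "lead_coeff q = 1" by (simp add: cq)
  have int: "coeff q i \<in> \<int>" for i using p(2) by (auto simp: cq)
  have "poly q (of_int d * x) = of_int d ^ m * x ^ m + (\<Sum>i<m. coeff p i * of_int d ^ (m - 1 - i) * (of_int d * x) ^ i)"
    by (simp add: q_def poly_monom poly_sum power_mult_distrib)
  also have "(\<Sum>i<m. coeff p i * of_int d ^ (m - 1 - i) * (of_int d * x) ^ i)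
     = (\<Sum>i<m. of_int d ^ (m - 1) * (coeff p i * x ^ i))"
  proof (intro sum.cong refl)
    fix i assume "i \<in> {..<m}"
    then have "m - 1 - i + i = m - 1" by auto
    then have "of_int d ^ (m - 1) = (of_int d ^ (m - 1 - i) * of_int d ^ i :: 'a)" by (metis power_add)
    then show "coeff p i * of_int d ^ (m - 1 - i) * (of_int d * x) ^ i = of_int d ^ (m - 1) * (coeff p i * x ^ i)"
      by (simp add: power_mult_distrib)
  qed
  also have "of_int d ^ m * x ^ m = of_int d ^ (m - 1) * (coeff p m * x ^ m)"
    using d m by (cases m) (simp_all add: m_def[symmetric])
  also have "of_int d ^ (m - 1) * (coeff p m * x ^ m) + (\<Sum>i<m. of_int d ^ (m - 1) * (coeff p i * x ^ i))
     = of_int d ^ (m - 1) * poly p x"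
    by (simp add: poly_altdef m_def[symmetric] lessThan_Suc_atMost[symmetric] sum_distrib_left algebra_simps)
  finally have "poly q (of_int d * x) = 0" using p(3) by simp
  then have "algebraic_int (of_int d * x)" using lead int by (auto intro: algebraic_int.intros)
  moreover have "d \<noteq> 0" using d p(1) by auto
  ultimately show ?thesis by (rule that[rotated])
qed

section \<open>Integer linear systems and multiplicative relations\<close>

lemma int_homogeneous_solution:
  fixes f :: "'i \<Rightarrow> 'j \<Rightarrow> int"
  assumes "finite J" "finite I" "card J < card I"
  obtains c where "\<exists>i\<in>I. c i \<noteq> 0" "\<And>j. j \<in> J \<Longrightarrow> (\<Sum>i\<in>I. c i * f i j) = 0"
proof -
  have "\<exists>c. (\<exists>i\<in>I. c i \<noteq> 0) \<and> (\<forall>j\<in>J. (\<Sum>i\<in>I. c i * f i j) = 0)"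
    using assms
  proof (induction J arbitrary: I f rule: finite_induct)
    case empty
    then have "I \<noteq> {}" by auto
    then show ?case by (intro exI[of _ "\<lambda>_. 1"]) auto
  next
    case (insert j J)
    show ?case
    proof (cases "\<forall>i\<in>I. f i j = 0")
      case True
      have "card J < card I" using insert.prems(2) insert.hyps by simp
      then obtain c where "\<exists>i\<in>I. c i \<noteq> 0" "\<forall>j\<in>J. (\<Sum>i\<in>I. c i * f i j) = 0"
        using insert.IH[OF insert.prems(1), of f] by blast
      moreover have "(\<Sum>i\<in>I. c i * f i j) = 0" using True by (intro sum.neutral) simp
      ultimately show ?thesis by (intro exI[of _ c]) simp
    next
      case False
      then obtain i0 where i0: "i0 \<in> I" "f i0 j \<noteq> 0" by blast
      let ?I = "I - {i0}"
      have "card J < card ?I" using insert.prems insert.hyps i0 by (simp add: card_Diff_singleton)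
      moreover have "finite ?I" using insert.prems(1) by simp
      \<comment> \<open>One step of fraction-free Gaussian elimination: cross-multiplying with the
        pivot \<open>f i0 j\<close> removes equation \<open>j\<close> and keeps the coefficients
        integral.\<close>
      ultimately obtain c where c: "\<exists>i\<in>?I. c i \<noteq> 0" "\<forall>k\<in>J. (\<Sum>i\<in>?I. c i * (f i0 j * f i k - f i j * f i0 k)) = 0"
        using insert.IH[of ?I "\<lambda>i k. f i0 j * f i k - f i j * f i0 k"] by blast
      \<comment> \<open>The value at \<open>i0\<close> is forced by equation \<open>j\<close>; the
        nonzero factor \<open>f i0 j\<close> elsewhere keeps the solution nontrivial.\<close>
      define c' where "c' i = (if i = i0 then - (\<Sum>i\<in>?I. c i * f i j) else c i * f i0 j)" for i
      have sum: "(\<Sum>i\<in>I. c' i * f i k) = (\<Sum>i\<in>?I. c i * (f i0 j * f i k - f i j * f i0 k))" for k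
      proof -
        have "(\<Sum>i\<in>I. c' i * f i k) = c' i0 * f i0 k + (\<Sum>i\<in>?I. c' i * f i k)"
          using insert.prems i0 by (simp add: sum.remove)
        also have "(\<Sum>i\<in>?I. c' i * f i k) = (\<Sum>i\<in>?I. c i * f i0 j * f i k)"
          by (intro sum.cong) (auto simp: c'_def)
        finally show ?thesis
          by (simp add: c'_def sum_distrib_left sum_distrib_right algebra_simps sum_subtractf)
      qed
      have "(\<Sum>i\<in>I. c' i * f i j) = 0" unfolding sum by (intro sum.neutral) simp
      moreover have "\<exists>i\<in>I. c' i \<noteq> 0" using c(1) i0 by (auto simp: c'_def)
      ultimately show ?thesis using sum c(2) by (intro exI[of _ c']) simp
    qed
  qed
  then show ?thesis using that by blast
qed

lemma power_int_sum: "(x::'a::field) \<noteq> 0 \<Longrightarrow> x powi sum f A = (\<Prod>i\<in>A. x powi f i)"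
  by (induction A rule: infinite_finite_induct) (auto simp: power_int_add)

lemma prod_power_int: "(\<Prod>i\<in>A. f i) powi k = (\<Prod>i\<in>A. (f i :: 'a::field) powi k)"
  by (induction A rule: infinite_finite_induct) (auto simp: power_int_mult_distrib)

lemma group_mult_group: "group mult_group"
  by (rule groupI) (auto simp: mult_group_def intro!: bexI[of _ "inverse _"])

lemma generate_mult_group:
  assumes "finite C" "0 \<notin> C" "s \<in> generate mult_group C"
  shows "\<exists>e. s = (\<Prod>c\<in>C. c powi e c)"
  using assms(3)
proof (induction rule: generate.induct)
  case one
  show ?case by (intro exI[of _ "\<lambda>_. 0"]) (simp add: mult_group_def)
next
  case (incl x)
  have "(\<Prod>c\<in>C. c powi (if c = x then 1 else 0)) = (\<Prod>c\<in>C. if c = x then c else 1)"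
    by (intro prod.cong) auto
  then show ?case using incl assms by (intro exI[of _ "\<lambda>c. if c = x then 1 else 0"]) simp
next
  case (inv x)
  have nz: "x \<noteq> 0" using inv assms by auto
  interpret group mult_group by (rule group_mult_group)
  have "inv\<^bsub>mult_group\<^esub> x = inverse x"
    by (rule inv_equality) (use nz in \<open>auto simp: mult_group_def\<close>)
  moreover have "(\<Prod>c\<in>C. c powi (if c = x then -1 else 0)) = (\<Prod>c\<in>C. if c = x then inverse c else 1)"
    by (intro prod.cong) (auto simp: power_int_minus)
  ultimately show ?case using inv assms by (intro exI[of _ "\<lambda>c. if c = x then -1 else 0"]) simp
next
  case (eng x y)
  then obtain e e' where "x = (\<Prod>c\<in>C. c powi e c)" "y = (\<Prod>c\<in>C. c powi e' c)" by blast
  then have "x \<otimes>\<^bsub>mult_group\<^esub> y = (\<Prod>c\<in>C. c powi (e c + e' c))"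
    using assms by (auto simp: mult_group_def prod.distrib[symmetric] intro!: prod.cong power_int_add[symmetric])
  then show ?case by (intro exI[of _ "\<lambda>c. e c + e' c"])
qed

text \<open>Exchange argument for exponent vectors: the members of \<open>S\<close> are monomials in
  \<open>C\<close>, so a relation on \<open>C\<close> together with the vectors of \<open>S\<close>
  gives more integer vectors than coordinates. It turns a rank condition on a generated group into
  independence of the generators themselves.\<close>

lemma independent_generators:
  assumes C: "finite C" "0 \<notin> C" and S: "S \<subseteq> generate mult_group C" "mult_independent S"
    and le: "card C \<le> card S"
  shows "mult_independent C" "card C = card S"
proof -
  have fS: "finite S" using S(2) by (simp add: mult_independent_def)
  have "\<forall>s\<in>S. \<exists>e. s = (\<Prod>c\<in>C. c powi e c)"
    using generate_mult_group[OF C] S(1) by blast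
  then obtain M where M: "\<And>s. s \<in> S \<Longrightarrow> s = (\<Prod>c\<in>C. c powi M s c)" by metis
  have comb: "(\<Prod>s\<in>S. s powi c s) = (\<Prod>j\<in>C. j powi (\<Sum>s\<in>S. c s * M s j))" for c
  proof -
    have "(\<Prod>s\<in>S. s powi c s) = (\<Prod>s\<in>S. \<Prod>j\<in>C. j powi (c s * M s j))"
      by (intro prod.cong refl, subst M)
         (simp_all add: prod_power_int power_int_mult[symmetric] mult.commute)
    also have "\<dots> = (\<Prod>j\<in>C. \<Prod>s\<in>S. j powi (c s * M s j))" by (rule prod.swap)
    also have "\<dots> = (\<Prod>j\<in>C. j powi (\<Sum>s\<in>S. c s * M s j))"
      using C(2) by (intro prod.cong refl power_int_sum[symmetric]) auto
    finally show ?thesis .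
  qed
  show "mult_independent C"
    unfolding mult_independent_def
  proof (intro conjI C(1) allI impI ballI)
    fix e :: "'a \<Rightarrow> int" and x
    assume e: "(\<Prod>x\<in>C. x powi e x) = 1" and x: "x \<in> C"
    \<comment> \<open>\<open>None\<close> labels the exponent vector of the given relation and
      \<open>Some s\<close> that of \<open>s\<close>. Independence of \<open>S\<close> will kill the
      coefficients at \<open>Some s\<close>, so the one at \<open>None\<close> survives.\<close>
    let ?I = "insert None (Some ` S)"
    let ?f = "\<lambda>i. case i of None \<Rightarrow> e | Some s \<Rightarrow> M s"
    have "card C < card ?I" using fS le by (simp add: card_image card_insert_if image_iff)
    then obtain c where c: "\<exists>i\<in>?I. c i \<noteq> 0" "\<And>j. j \<in> C \<Longrightarrow> (\<Sum>i\<in>?I. c i * ?f i j) = 0"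
      using int_homogeneous_solution[OF C(1), of ?I ?f] fS by auto
    have eq: "(\<Sum>s\<in>S. c (Some s) * M s j) = - (c None * e j)" if "j \<in> C" for j
      using c(2)[OF that] fS by (simp add: sum.reindex image_iff eq_neg_iff_add_eq_0 add.commute)
    have "(\<Prod>s\<in>S. s powi c (Some s)) = (\<Prod>j\<in>C. (j powi e j) powi (- c None))"
      unfolding comb by (intro prod.cong refl) (simp only: eq power_int_mult[symmetric] mult_minus_right mult.commute[of "c None"])
    also have "\<dots> = 1" by (simp only: prod_power_int[symmetric] e) simp
    finally have "\<forall>s\<in>S. c (Some s) = 0" using S(2) unfolding mult_independent_def
      by (elim conjE allE[of _ "\<lambda>s. c (Some s)"]) simp
    then have "c None \<noteq> 0" "c None * e x = 0" using c(1) eq[OF x] by auto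
    then show "e x = 0" by simp
  qed
  show "card C = card S"
  proof (rule ccontr)
    assume "card C \<noteq> card S"
    then have "card C < card S" using le by simp
    then obtain c where c: "\<exists>i\<in>S. c i \<noteq> 0" "\<And>j. j \<in> C \<Longrightarrow> (\<Sum>i\<in>S. c i * M i j) = 0"
      using int_homogeneous_solution[OF C(1) fS, of M] by auto
    then have "(\<Prod>s\<in>S. s powi c s) = 1" unfolding comb by simp
    then show False using c(1) S(2) unfolding mult_independent_def by blast
  qed
qed

section \<open>Independence of the conjugates\<close>

lemma rat_basis:
  assumes "finite_galois_over_rat TYPE('a)"
  obtains B :: "'a::field_char_0 set" where "finite B" "rat_vs.independent B" "rat_vs.span B = UNIV"
    "card B = degree_over_rat TYPE('a)"
proof -
  obtain B0 :: "'a set" where B0: "finite B0" "rat_vs.span B0 = UNIV"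
    using assms by (auto simp: finite_galois_over_rat_def)
  obtain B :: "'a set" where B: "rat_vs.independent B" "UNIV \<subseteq> rat_vs.span B"
    "card B = rat_vs.dim (UNIV :: 'a set)"
    using rat_vs.basis_exists[of UNIV] by metis
  have "finite B" using rat_vs.independent_span_bound[OF B0(1) B(1)] B0(2) by simp
  then show ?thesis using that B by (auto simp: degree_over_rat_def)
qed

text \<open>Dependence of the set of powers does not see coinciding powers, so a repetition
  \<open>x ^ i = x ^ j\<close> is a separate alternative and yields
  \<open>X ^ i - X ^ j\<close>.\<close>

lemma dependent_powers_imp_poly:
  fixes x :: "'a::field_char_0"
  assumes "rat_vs.dependent ((\<lambda>i. x ^ i) ` A) \<or> \<not> inj_on (\<lambda>i. x ^ i) A" "A \<subseteq> {..N::nat}"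
  obtains g where "g \<noteq> 0" "degree g \<le> N" "\<And>i. coeff g i \<in> \<rat>" "poly g x = 0"
proof (cases "inj_on (\<lambda>i. x ^ i) A")
  case True
  have fA: "finite A" using assms(2) finite_subset by blast
  have "rat_vs.dependent ((\<lambda>i. x ^ i) ` A)" using True assms(1) by blast
  then obtain u where u: "\<exists>v\<in>(\<lambda>i. x ^ i) ` A. u v \<noteq> 0"
      "(\<Sum>v\<in>(\<lambda>i. x ^ i) ` A. rat_scale (u v) v) = 0"
    using fA by (auto simp: rat_vs.dependent_finite)
  define g where "g = (\<Sum>i\<in>A. monom (of_rat (u (x ^ i))) i :: 'a poly)"
  have cg: "coeff g k = (if k \<in> A then of_rat (u (x ^ k)) else 0)" for k
    using fA by (simp add: g_def coeff_sum)
  show ?thesis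
  proof (rule that)
    from u(1) obtain i where "i \<in> A" "u (x ^ i) \<noteq> 0" by blast
    then have "coeff g i \<noteq> 0" by (simp add: cg)
    then show "g \<noteq> 0" by auto
    show "degree g \<le> N" using assms(2) by (intro degree_le) (auto simp: cg)
    show "coeff g i \<in> \<rat>" for i by (simp add: cg)
    have "poly g x = (\<Sum>i\<in>A. of_rat (u (x ^ i)) * x ^ i)"
      by (simp add: g_def poly_sum poly_monom)
    also have "\<dots> = 0" using u(2) by (simp add: sum.reindex[OF True] rat_scale_def)
    finally show "poly g x = 0" .
  qed
next
  case False
  then obtain i j where ij: "i \<in> A" "j \<in> A" "i \<noteq> j" "x ^ i = x ^ j" by (auto simp: inj_on_def)
  define g where "g = (monom 1 i - monom 1 j :: 'a poly)"
  have cg: "coeff g k = (if k = i then 1 else 0) - (if k = j then 1 else 0)" for k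
    by (simp add: g_def)
  show ?thesis
  proof (rule that)
    have "coeff g i \<noteq> 0" using ij by (simp add: cg)
    then show "g \<noteq> 0" by auto
    show "degree g \<le> N" using assms(2) ij by (intro degree_le) (auto simp: cg)
    show "coeff g i \<in> \<rat>" for i by (simp add: cg)
    show "poly g x = 0" using ij by (simp add: g_def poly_monom)
  qed
qed

text \<open>The rank is the largest possible, since at most \<open>degree_over_rat\<close>
  conjugates generate the module. \<open>integers_cring\<close> provides closure of the algebraic
  integers under sum and product; the final proof settles it by cases.\<close>

locale conjugates_independent =
  fixes \<eta> :: "'a::field_char_0"
  assumes galois: "finite_galois_over_rat TYPE('a)"
    and rank: "has_mult_rank (galois_module \<eta>) (degree_over_rat TYPE('a))"
    and eta_nz: "\<eta> \<noteq> 0"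
    and integers_cring: "cring (ring_of_integers :: 'a ring)"
begin

definition conjugates :: "'a set" where "conjugates = (\<lambda>\<sigma>. \<sigma> \<eta>) ` Gal"

lemma exists_rat_poly:
  obtains g where "g \<noteq> 0" "degree g \<le> degree_over_rat TYPE('a)" "\<And>i. coeff g i \<in> \<rat>" "poly g (x::'a) = 0"
proof -
  let ?n = "degree_over_rat TYPE('a)"
  obtain B :: "'a set" where B: "finite B" "rat_vs.span B = UNIV" "card B = ?n"
    using rat_basis[OF galois] by metis
  have "rat_vs.dependent ((\<lambda>i. x ^ i) ` {..?n}) \<or> \<not> inj_on (\<lambda>i. x ^ i) {..?n}"
  proof (rule ccontr)
    assume *: "\<not> ?thesis"
    then have "card ((\<lambda>i. x ^ i) ` {..?n}) = Suc ?n" by (simp add: card_image)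
    then show False using rat_vs.independent_span_bound[OF B(1), of "(\<lambda>i. x ^ i) ` {..?n}"] B * by simp
  qed
  then show ?thesis using dependent_powers_imp_poly[of x "{..?n}" ?n] that by auto
qed

lemma algebraic: "algebraic (x::'a)"
  by (rule exists_rat_poly[of x]) (auto intro: algebraicI')

lemma conjugates_roots:
  assumes "\<And>i. coeff g i \<in> \<rat>" "poly g \<eta> = 0" "c \<in> conjugates"
  shows "poly g c = 0"
proof -
  from assms(3) obtain \<sigma> where s: "\<sigma> \<in> Gal" "c = \<sigma> \<eta>" by (auto simp: conjugates_def)
  then have "poly g c = \<sigma> (poly g \<eta>)" using assms(1) by (simp add: Gal_poly_rat)
  then show ?thesis using s assms(2) by (simp add: Gal_simps(1))
qed

lemma finite_conjugates: "finite conjugates"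
  and card_conjugates_le: "card conjugates \<le> degree_over_rat TYPE('a)"
proof -
  obtain g where g: "g \<noteq> 0" "degree g \<le> degree_over_rat TYPE('a)" "\<And>i. coeff g i \<in> \<rat>" "poly g \<eta> = 0"
    using exists_rat_poly[of \<eta>] by blast
  have sub: "conjugates \<subseteq> {x. poly g x = 0}" using conjugates_roots[OF g(3,4)] by blast
  have fin: "finite {x. poly g x = 0}" using g(1) by (rule poly_roots_finite)
  show "finite conjugates" using sub fin by (rule finite_subset)
  have "card conjugates \<le> card {x. poly g x = 0}" using fin sub by (rule card_mono)
  also have "\<dots> \<le> degree g" using g(1) by (rule card_poly_roots_bound)
  finally show "card conjugates \<le> degree_over_rat TYPE('a)" using g(2) by simp
qed

lemma zero_notin_conjugates: "0 \<notin> conjugates"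
  using eta_nz by (auto simp: conjugates_def Gal_simps(8) dest!: sym[of 0])

text \<open>A root count leaves at most \<open>degree_over_rat\<close> conjugates, while they
  generate a group containing that many independent elements; so the count is exact and no relation
  is left.\<close>

lemma conjugates_mult_independent: "mult_independent conjugates"
  and card_conjugates: "card conjugates = degree_over_rat TYPE('a)"
proof -
  obtain S where S: "S \<subseteq> generate mult_group conjugates" "mult_independent S"
      "card S = degree_over_rat TYPE('a)"
    using rank by (auto simp: has_mult_rank_def galois_module_def conjugates_def)
  note * = independent_generators[OF finite_conjugates zero_notin_conjugates S(1,2)]
  show "mult_independent conjugates" "card conjugates = degree_over_rat TYPE('a)"
    using * S(3) card_conjugates_le by simp_all
qed

lemma degree_over_rat_pos: "degree_over_rat TYPE('a) > 0"
proof -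
  have "id \<eta> \<in> conjugates" unfolding conjugates_def using Gal_id by (rule imageI)
  then have "card conjugates > 0" using finite_conjugates by (auto simp: card_gt_0_iff)
  then show ?thesis using card_conjugates by simp
qed

text \<open>A rational polynomial killing \<open>\<eta>\<close> kills all its conjugates, so by counting roots the powers
  of \<open>\<eta>\<close> below the degree form a basis.\<close>

lemma span_powers: "rat_vs.span ((\<lambda>i. \<eta> ^ i) ` {..<degree_over_rat TYPE('a)}) = UNIV"
proof -
  let ?n = "degree_over_rat TYPE('a)" let ?S = "(\<lambda>i. \<eta> ^ i) ` {..<?n}"
  obtain B :: "'a set" where B: "finite B" "rat_vs.span B = UNIV" "card B = ?n"
    using rat_basis[OF galois] by metis
  note n = degree_over_rat_pos
  have "\<not> (rat_vs.dependent ?S \<or> \<not> inj_on (\<lambda>i. \<eta> ^ i) {..<?n})"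
  proof
    assume "rat_vs.dependent ?S \<or> \<not> inj_on (\<lambda>i. \<eta> ^ i) {..<?n}"
    moreover have "{..<?n} \<subseteq> {..?n - 1}" by auto
    ultimately obtain g where g: "g \<noteq> 0" "degree g \<le> ?n - 1" "\<And>i. coeff g i \<in> \<rat>" "poly g \<eta> = 0"
      by (rule dependent_powers_imp_poly) metis
    have "card conjugates \<le> card {x. poly g x = 0}"
      using conjugates_roots[OF g(3,4)] poly_roots_finite[OF g(1)] by (intro card_mono) auto
    also have "\<dots> \<le> degree g" using g(1) by (rule card_poly_roots_bound)
    finally show False using g(2) n card_conjugates by simp
  qed
  then have S: "rat_vs.independent ?S" "card ?S = ?n" by (auto simp: card_image)
  have "y \<in> rat_vs.span ?S" for y
  proof (rule ccontr)
    assume y: "y \<notin> rat_vs.span ?S"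
    then have "rat_vs.independent (insert y ?S)" using S(1) by (rule rat_vs.independent_insertI)
    moreover have "card (insert y ?S) = Suc ?n"
      using y S(2) rat_vs.span_base[of y ?S] by (subst card_insert_disjoint) auto
    ultimately show False using rat_vs.independent_span_bound[OF B(1), of "insert y ?S"] B by simp
  qed
  then show ?thesis by blast
qed

text \<open>Both maps are linear over the rationals and agree on the powers of \<eta>, which span.
  Hence \<open>diff_prod\<close> is nonzero, and powers of Frobenius elements can be compared at
  \<eta> alone.\<close>

lemma Gal_eqI:
  assumes "\<sigma> \<in> Gal" "\<tau> \<in> Gal" "\<sigma> \<eta> = \<tau> \<eta>"
  shows "\<sigma> = \<tau>"
proof
  fix x
  have "rat_vs.subspace {x. \<sigma> x = \<tau> x}"
    using assms by (auto simp: rat_vs.subspace_def rat_scale_def Gal_simps GalD(4))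
  moreover have "(\<lambda>i. \<eta> ^ i) ` {..<degree_over_rat TYPE('a)} \<subseteq> {x. \<sigma> x = \<tau> x}"
    using assms by (auto simp: Gal_simps(7))
  ultimately have "rat_vs.span ((\<lambda>i. \<eta> ^ i) ` {..<degree_over_rat TYPE('a)}) \<subseteq> {x. \<sigma> x = \<tau> x}"
    by (rule rat_vs.span_minimal[rotated])
  then show "\<sigma> x = \<tau> x" using span_powers by auto
qed

lemma finite_Gal: "finite (Gal :: ('a \<Rightarrow> 'a) set)"
proof (rule finite_imageD)
  show "finite ((\<lambda>\<sigma>. \<sigma> \<eta>) ` Gal)" using finite_conjugates by (simp add: conjugates_def)
  show "inj_on (\<lambda>\<sigma>. \<sigma> \<eta>) Gal" using Gal_eqI by (auto intro: inj_onI)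
qed

lemma algebraic_int_add: "algebraic_int (x::'a) \<Longrightarrow> algebraic_int y \<Longrightarrow> algebraic_int (x + y)"
  and algebraic_int_mult: "algebraic_int (x::'a) \<Longrightarrow> algebraic_int y \<Longrightarrow> algebraic_int (x * y)"
proof -
  interpret cring "ring_of_integers :: 'a ring" by (rule integers_cring)
  show "algebraic_int (x + y)" if "algebraic_int (x::'a)" "algebraic_int y"
    using a_closed[of x y] that by (simp add: ring_of_integers_def)
  show "algebraic_int (x * y)" if "algebraic_int (x::'a)" "algebraic_int y"
    using m_closed[of x y] that by (simp add: ring_of_integers_def)
qed

lemma fixed_imp_rat:
  assumes "\<And>\<sigma>. \<sigma> \<in> Gal \<Longrightarrow> \<sigma> x = (x::'a)"
  shows "x \<in> \<rat>"
  using assms galois by (auto simp: finite_galois_over_rat_def Rats_def)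

section \<open>Lagrange interpolation at the conjugates\<close>

definition root_poly :: "'a poly" where
  "root_poly = (\<Prod>\<sigma>\<in>Gal. [:- \<sigma> \<eta>, 1:])"

text \<open>Lagrange interpolation: \<open>lagrange x\<close> takes the value \<open>\<sigma> (x * diff_prod)\<close> at \<open>\<sigma> \<eta>\<close>.\<close>

definition lagrange :: "'a \<Rightarrow> 'a poly" where
  "lagrange x = (\<Sum>\<sigma>\<in>Gal. smult (\<sigma> x) (\<Prod>\<tau>\<in>Gal - {\<sigma>}. [:- \<tau> \<eta>, 1:]))"

text \<open>This is the derivative of \<open>root_poly\<close> at \<eta>, the denominator of the
  interpolation formula. Leaving it on the side of the value keeps \<open>lagrange\<close> free of
  division.\<close>

definition diff_prod :: 'a where
  "diff_prod = (\<Prod>\<tau>\<in>Gal - {id}. \<eta> - \<tau> \<eta>)"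

lemma diff_prod_nz: "diff_prod \<noteq> 0"
  using finite_Gal Gal_eqI[of id] by (auto simp: diff_prod_def)

lemma coeff_rat_if_Gal_invariant:
  assumes "\<And>\<sigma>. \<sigma> \<in> Gal \<Longrightarrow> map_poly \<sigma> g = (g :: 'a poly)"
  shows "coeff g i \<in> \<rat>"
proof (rule fixed_imp_rat)
  fix \<sigma> :: "'a \<Rightarrow> 'a" assume s: "\<sigma> \<in> Gal"
  have "coeff (map_poly \<sigma> g) i = \<sigma> (coeff g i)" using s by (simp add: coeff_map_poly Gal_simps(1))
  then show "\<sigma> (coeff g i) = coeff g i" using assms[OF s] by simp
qed

lemma map_poly_linear: "\<sigma> \<in> Gal \<Longrightarrow> map_poly \<sigma> [:- x, 1:] = [:- \<sigma> x, 1:]"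
  by (simp add: map_poly_pCons Gal_simps[of \<sigma>])

lemma coeff_root_poly_rat: "coeff root_poly i \<in> \<rat>"
proof (rule coeff_rat_if_Gal_invariant)
  fix \<rho> :: "'a \<Rightarrow> 'a" assume r: "\<rho> \<in> Gal"
  have "map_poly \<rho> root_poly = (\<Prod>\<sigma>\<in>Gal. [:- (\<rho> \<circ> \<sigma>) \<eta>, 1:])"
    unfolding root_poly_def by (simp add: map_poly_Gal_prod map_poly_linear r)
  also have "\<dots> = root_poly"
    unfolding root_poly_def using prod.reindex_bij_betw[OF bij_betw_comp_Gal[OF r], of "\<lambda>\<sigma>. [:- \<sigma> \<eta>, 1:]"] .
  finally show "map_poly \<rho> root_poly = root_poly" .
qed

text \<open>Applying \<rho> to the coefficients moves the summand at \<sigma> to the summand at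
  \<open>\<rho> \<circ> \<sigma>\<close>, so the sum is Galois invariant.\<close>

lemma coeff_lagrange_rat: "coeff (lagrange x) i \<in> \<rat>"
proof (rule coeff_rat_if_Gal_invariant)
  fix \<rho> :: "'a \<Rightarrow> 'a" assume r: "\<rho> \<in> Gal"
  let ?h = "\<lambda>\<sigma>. smult (\<sigma> x) (\<Prod>\<tau>\<in>Gal - {\<sigma>}. [:- \<tau> \<eta>, 1:])"
  have "map_poly \<rho> (lagrange x) = (\<Sum>\<sigma>\<in>Gal. smult (\<rho> (\<sigma> x)) (\<Prod>\<tau>\<in>Gal - {\<sigma>}. [:- (\<rho> \<circ> \<tau>) \<eta>, 1:]))"
    unfolding lagrange_def using r
    by (simp add: map_poly_Gal_sum map_poly_smult map_poly_Gal_prod map_poly_linear Gal_simps[OF r])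
  also have "\<dots> = (\<Sum>\<sigma>\<in>Gal. ?h (\<rho> \<circ> \<sigma>))"
  proof (intro sum.cong refl)
    fix \<sigma> :: "'a \<Rightarrow> 'a" assume s: "\<sigma> \<in> Gal"
    have "bij_betw ((\<circ>) \<rho>) (Gal - {\<sigma>}) (Gal - {\<rho> \<circ> \<sigma>})"
      using bij_betw_DiffI[OF bij_betw_comp_Gal[OF r], of "{\<sigma>}" "{\<rho> \<circ> \<sigma>}"] s r by simp
    then have "(\<Prod>\<tau>\<in>Gal - {\<sigma>}. [:- (\<rho> \<circ> \<tau>) \<eta>, 1:]) = (\<Prod>\<tau>\<in>Gal - {\<rho> \<circ> \<sigma>}. [:- \<tau> \<eta>, 1:])"
      by (rule prod.reindex_bij_betw)
    then show "smult (\<rho> (\<sigma> x)) (\<Prod>\<tau>\<in>Gal - {\<sigma>}. [:- (\<rho> \<circ> \<tau>) \<eta>, 1:]) = ?h (\<rho> \<circ> \<sigma>)" by simp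
  qed
  also have "\<dots> = lagrange x"
    unfolding lagrange_def using sum.reindex_bij_betw[OF bij_betw_comp_Gal[OF r], of ?h] .
  finally show "map_poly \<rho> (lagrange x) = lagrange x" .
qed

text \<open>For \<sigma> other than the identity the product over the remaining automorphisms
  contains the vanishing factor at \<open>id\<close>.\<close>

lemma poly_lagrange_eta: "poly (lagrange x) \<eta> = x * diff_prod"
proof -
  have "poly (lagrange x) \<eta> = (\<Sum>\<sigma>\<in>Gal. \<sigma> x * (\<Prod>\<tau>\<in>Gal - {\<sigma>}. \<eta> - \<tau> \<eta>))"
    by (simp add: lagrange_def poly_sum poly_prod)
  also have "\<dots> = (\<Sum>\<sigma>\<in>(Gal :: ('a \<Rightarrow> 'a) set). if \<sigma> = id then x * diff_prod else 0)"
  proof (rule sum.cong[OF refl])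
    fix \<sigma> :: "'a \<Rightarrow> 'a" assume "\<sigma> \<in> Gal"
    show "\<sigma> x * (\<Prod>\<tau>\<in>Gal - {\<sigma>}. \<eta> - \<tau> \<eta>) = (if \<sigma> = id then x * diff_prod else 0)"
    proof (cases "\<sigma> = id")
      case False
      then have "id \<in> Gal - {\<sigma>}" by simp
      then have "(\<Prod>\<tau>\<in>Gal - {\<sigma>}. \<eta> - \<tau> \<eta>) = 0"
        using finite_Gal by (intro prod_zero bexI[of _ id]) simp_all
      then show ?thesis using False by simp
    qed (simp add: diff_prod_def)
  qed
  also have "\<dots> = x * diff_prod" using finite_Gal by simp
  finally show ?thesis .
qed

text \<open>The bound is not sharp; what counts is one range of coefficients valid for all
  \<open>x\<close>.\<close>

lemma degree_lagrange: "degree (lagrange x) \<le> card (Gal :: ('a \<Rightarrow> 'a) set)"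
  unfolding lagrange_def
proof (rule degree_sum_le[OF finite_Gal])
  fix \<sigma> :: "'a \<Rightarrow> 'a"
  have "degree (\<Prod>\<tau>\<in>Gal - {\<sigma>}. [:- \<tau> \<eta>, 1:]) \<le> (\<Sum>\<tau>\<in>Gal - {\<sigma>}. 1)"
    using degree_prod_sum_le[of "Gal - {\<sigma>}" "\<lambda>\<tau>. [:- \<tau> \<eta>, 1:]"] finite_Gal by simp
  also have "\<dots> \<le> card (Gal :: ('a \<Rightarrow> 'a) set)" using finite_Gal by (simp add: card_mono)
  finally show "degree (smult (\<sigma> x) (\<Prod>\<tau>\<in>Gal - {\<sigma>}. [:- \<tau> \<eta>, 1:])) \<le> card (Gal :: ('a \<Rightarrow> 'a) set)"
    using degree_smult_le le_trans by blast
qed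

end

section \<open>The ring of p-integral elements\<close>

locale p_local = conjugates_independent \<eta> for \<eta> :: "'a::field_char_0" +
  fixes p :: nat
  assumes prime_p: "Factorial_Ring.prime p"
begin

definition R :: "'a set" where
  "R = {a / of_int m | a m. algebraic_int a \<and> \<not> int p dvd m}"

definition pR :: "'a set" where
  "pR = (*) (of_nat p) ` R"

lemma carrier_p_integers: "carrier (p_integers p) = R"
  by (simp add: p_integers_def ring_of_integers_def R_def)

lemma prime_int_p: "Factorial_Ring.prime (int p)"
  using prime_p by simp

lemma R_I: "algebraic_int a \<Longrightarrow> \<not> int p dvd m \<Longrightarrow> a / of_int m \<in> R"
  by (auto simp: R_def)

lemma R_E:
  assumes "x \<in> R"
  obtains a m where "x = a / of_int m" "algebraic_int a" "\<not> int p dvd m" "m \<noteq> 0"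
  using assms by (auto simp: R_def)

lemma not_dvd_one: "\<not> int p dvd 1"
  using prime_int_p not_prime_unit by blast

lemma not_dvd_mult: "\<not> int p dvd m \<Longrightarrow> \<not> int p dvd k \<Longrightarrow> \<not> int p dvd m * k"
  using prime_int_p by (simp add: prime_dvd_mult_iff)

lemma R_algebraic_int: "algebraic_int x \<Longrightarrow> x \<in> R"
  using R_I[of x 1] not_dvd_one by simp

lemma R_of_int [simp]: "of_int k \<in> R"
  by (intro R_algebraic_int int_imp_algebraic_int) simp

lemma R_of_nat [simp]: "of_nat k \<in> R"
  using R_of_int[of "int k"] by simp

lemma R_0 [simp]: "0 \<in> R" and R_1 [simp]: "1 \<in> R"
  using R_of_int[of 0] R_of_int[of 1] by simp_all

lemma R_add [simp]: "x \<in> R \<Longrightarrow> y \<in> R \<Longrightarrow> x + y \<in> R"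
proof (elim R_E)
  fix a m b k
  assume *: "x = a / of_int m" "algebraic_int a" "\<not> int p dvd m" "m \<noteq> 0"
    "y = b / of_int k" "algebraic_int b" "\<not> int p dvd k" "k \<noteq> 0"
  then have "x + y = (a * of_int k + b * of_int m) / of_int (m * k)" by (simp add: field_simps)
  moreover have "algebraic_int (a * of_int k + b * of_int m)"
    using *(2,6) by (intro algebraic_int_add algebraic_int_mult) (simp_all add: int_imp_algebraic_int)
  ultimately show "x + y \<in> R" using *(3,7) by (simp only: R_I not_dvd_mult not_False_eq_True)
qed

lemma R_mult [simp]: "x \<in> R \<Longrightarrow> y \<in> R \<Longrightarrow> x * y \<in> R"
proof (elim R_E)
  fix a m b k
  assume *: "x = a / of_int m" "algebraic_int a" "\<not> int p dvd m" "m \<noteq> 0"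
    "y = b / of_int k" "algebraic_int b" "\<not> int p dvd k" "k \<noteq> 0"
  then have "x * y = (a * b) / of_int (m * k)" by simp
  then show "x * y \<in> R" using *(2,3,6,7) by (simp only: R_I algebraic_int_mult not_dvd_mult not_False_eq_True)
qed

lemma R_uminus [simp]: "x \<in> R \<Longrightarrow> - x \<in> R"
  using R_mult[of "of_int (-1)" x] R_of_int[of "-1"] by simp

lemma R_diff [simp]: "x \<in> R \<Longrightarrow> y \<in> R \<Longrightarrow> x - y \<in> R"
  using R_add[of x "- y"] by simp

lemma R_power [simp]: "x \<in> R \<Longrightarrow> x ^ k \<in> R"
  by (induction k) auto

lemma R_sum: "(\<And>i. i \<in> A \<Longrightarrow> f i \<in> R) \<Longrightarrow> sum f A \<in> R"
  by (induction A rule: infinite_finite_induct) auto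

lemma R_prod: "(\<And>i. i \<in> A \<Longrightarrow> f i \<in> R) \<Longrightarrow> prod f A \<in> R"
  by (induction A rule: infinite_finite_induct) auto

lemma R_inverse_int: "\<not> int p dvd m \<Longrightarrow> 1 / of_int m \<in> R"
  by (rule R_I) auto

lemma R_Gal: "\<sigma> \<in> Gal \<Longrightarrow> x \<in> R \<Longrightarrow> \<sigma> x \<in> R"
  by (elim R_E) (simp add: Gal_simps(10)[of \<sigma>] Gal_of_int[of \<sigma>] R_I algebraic_int_Gal[of \<sigma>])

lemma pR_I: "x \<in> R \<Longrightarrow> of_nat p * x \<in> pR"
  unfolding pR_def by (rule imageI)

lemma pR_0 [simp]: "0 \<in> pR"
  using pR_I[of 0] by simp

lemma pR_add: "x \<in> pR \<Longrightarrow> y \<in> pR \<Longrightarrow> x + y \<in> pR"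
  unfolding pR_def by (elim imageE) (simp only: distrib_left[symmetric], intro imageI R_add)

lemma pR_mult_left: "x \<in> R \<Longrightarrow> y \<in> pR \<Longrightarrow> x * y \<in> pR"
  unfolding pR_def by (elim imageE) (simp only: mult.left_commute[of x], intro imageI R_mult)

lemma pR_mult_right: "y \<in> pR \<Longrightarrow> x \<in> R \<Longrightarrow> y * x \<in> pR"
  using pR_mult_left[of x y] by (simp add: mult.commute)

lemma pR_uminus: "x \<in> pR \<Longrightarrow> - x \<in> pR"
  using pR_mult_left[of "-1" x] by simp

lemma pR_diff: "x \<in> pR \<Longrightarrow> y \<in> pR \<Longrightarrow> x - y \<in> pR"
  using pR_add[of x "- y"] pR_uminus[of y] by simp

lemma pR_sum: "(\<And>i. i \<in> A \<Longrightarrow> f i \<in> pR) \<Longrightarrow> sum f A \<in> pR"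
  by (induction A rule: infinite_finite_induct) (auto intro: pR_add)

lemma pR_subset: "pR \<subseteq> R"
  by (auto simp: pR_def)

lemma pR_of_int: "int p dvd k \<Longrightarrow> of_int k \<in> pR"
  by (elim dvdE) (auto intro!: pR_I)

text \<open>Clearing denominators makes \<open>a\<close> a rational algebraic integer, hence an
  integer, and \<open>p\<close> does not divide the denominator \<open>m\<close>. In particular
  \<open>p\<close> is no unit of \<open>R\<close>.\<close>

lemma of_int_in_pR:
  assumes "of_int k \<in> pR"
  shows "int p dvd k"
proof -
  from assms obtain y where y: "of_int k = of_nat p * y" "y \<in> R" unfolding pR_def by (rule imageE)
  from y(2) obtain a m where "y = a / of_int m" and am': "algebraic_int a" "\<not> int p dvd m" "m \<noteq> 0"
    by (rule R_E)
  with y have am: "of_int k = of_nat p * (a / of_int m)" "algebraic_int a" "\<not> int p dvd m" "m \<noteq> 0"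
    by simp_all
  have p0: "p \<noteq> 0" using prime_p by (metis not_prime_0)
  have "a = of_int (k * m) / of_nat p" using am(1,4) p0 by (simp add: field_simps)
  then have "a \<in> \<rat>" by (simp only: Rats_divide Rats_of_int Rats_of_nat)
  then obtain j where j: "a = of_int j" using rational_algebraic_int_is_int[OF am(2)] by (auto elim: Ints_cases)
  have "(of_int (k * m) :: 'a) = of_int (int p * j)"
    using am(1,4) j by (simp add: field_simps)
  then have "k * m = int p * j" by (simp only: of_int_eq_iff)
  then have "int p dvd k * m" by simp
  then show ?thesis using am(3) prime_int_p by (simp add: prime_dvd_mult_iff)
qed

lemma pR_power_diff:
  assumes "x - y \<in> pR" "x \<in> R" "y \<in> R"
  shows "x ^ k - y ^ k \<in> pR"
proof (induction k)
  case (Suc k)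
  have "x ^ Suc k - y ^ Suc k = (x - y) * x ^ k + y * (x ^ k - y ^ k)" by (simp add: algebra_simps)
  then show ?case using Suc assms by (simp only:) (intro pR_add pR_mult_left[of y] pR_mult_right R_power)
qed simp

lemma rat_residue:
  assumes "x \<in> R" "x \<in> \<rat>"
  shows "\<exists>c\<in>{0..<int p}. x - of_int c \<in> pR"
proof -
  from assms(1) obtain a m where am: "x = a / of_int m" "algebraic_int a" "\<not> int p dvd m" "m \<noteq> 0"
    by (rule R_E)
  have "a = x * of_int m" using am by simp
  then have "a \<in> \<rat>" using assms(2) by simp
  then obtain k where k: "a = of_int k" using rational_algebraic_int_is_int[OF am(2)] by (auto elim: Ints_cases)
  have "coprime m (int p)"
    using am(3) prime_int_p by (metis coprime_commute prime_imp_coprime)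
  then obtain m' where m': "[m * m' = 1] (mod int p)" using cong_solve_coprime_int by blast
  define c where "c = (k * m') mod int p"
  have "[c * m = k * m' * m] (mod int p)" unfolding c_def by (simp add: cong_def mod_mult_left_eq)
  also have "[k * m' * m = k] (mod int p)"
    using cong_scalar_left[OF m', of k] by (simp add: mult.assoc mult.commute[of m])
  finally have "int p dvd k - c * m" by (simp add: cong_iff_dvd_diff dvd_diff_commute)
  moreover have "x - of_int c = of_int (k - c * m) * (1 / of_int m)"
    using am(1,4) k by (simp add: field_simps)
  ultimately have "x - of_int c \<in> pR"
    using am(3) by (simp only:) (intro pR_mult_right pR_of_int R_inverse_int)
  moreover have "c \<in> {0..<int p}" using prime_p by (simp add: c_def prime_gt_0_nat)
  ultimately show ?thesis by blast
qed

lemma rat_fermat: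
  assumes "x \<in> R" "x \<in> \<rat>"
  shows "x ^ p - x \<in> pR"
proof -
  from rat_residue[OF assms] obtain c where c: "x - of_int c \<in> pR" "c \<ge> 0" by auto
  then obtain k where k: "c = int k" using nonneg_int_cases by blast
  have "[k ^ p = k] (mod p)"
  proof (cases "p dvd k")
    case True
    then have "p dvd k ^ p" using dvd_trans[OF True dvd_power[of p k]] prime_gt_0_nat[OF prime_p] by simp
    then show ?thesis using True by (simp add: cong_def)
  next
    case False
    from fermat_theorem[OF prime_p False] have "[k ^ (p - 1) * k = 1 * k] (mod p)" by (rule cong_scalar_right)
    moreover have "k ^ (p - 1) * k = k ^ p"
      using prime_gt_0_nat[OF prime_p] by (simp flip: power_Suc2)
    ultimately show ?thesis by simp
  qed
  then have "[c ^ p = c] (mod int p)" unfolding k using cong_int_iff[of "k ^ p" k p] by simp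
  then have "of_int (c ^ p - c) \<in> pR" by (intro pR_of_int) (simp add: cong_iff_dvd_diff)
  moreover have "x ^ p - of_int c ^ p \<in> pR" using c assms by (intro pR_power_diff) auto
  ultimately have "(x ^ p - of_int c ^ p) + of_int (c ^ p - c) - (x - of_int c) \<in> pR"
    by (rule pR_diff[OF pR_add c(1), rotated])
  then show ?thesis by simp
qed

lemma freshmans_dream_pR:
  assumes "x \<in> R" "y \<in> R"
  shows "(x + y) ^ p - (x ^ p + y ^ p) \<in> pR"
proof -
  have p: "p > 0" using prime_p by (rule prime_gt_0_nat)
  let ?t = "\<lambda>k. of_nat (p choose k) * x ^ k * y ^ (p - k)"
  have "{..p} = insert 0 (insert p {0<..<p})" using p by auto
  then have "(x + y) ^ p = x ^ p + y ^ p + (\<Sum>k\<in>{0<..<p}. ?t k)"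
    using p by (simp add: binomial_ring)
  moreover have "?t k \<in> pR" if k: "k \<in> {0<..<p}" for k
  proof -
    have "p dvd (p choose k)" using k prime_p by (intro dvd_choose_prime) auto
    then have "of_nat (p choose k) \<in> pR" using pR_of_int[of "int (p choose k)"] by simp
    then show ?thesis using assms by (auto intro!: pR_mult_right)
  qed
  ultimately show ?thesis using pR_sum[of "{0<..<p}" ?t] by simp
qed

lemma poly_R: "(\<And>i. coeff g i \<in> R) \<Longrightarrow> x \<in> R \<Longrightarrow> poly g x \<in> R"
  unfolding poly_altdef by (intro R_sum R_mult R_power)

text \<open>Raising to the power \<open>p\<close> is additive modulo \<open>p\<close>, and by Fermat
  it fixes the coefficients modulo \<open>p\<close>, which is why they have to be rational. The
  induction follows Horner's scheme.\<close>

lemma poly_frobenius: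
  assumes "\<And>i. coeff g i \<in> R" "\<And>i. coeff g i \<in> \<rat>" "x \<in> R"
  shows "poly g x ^ p - poly g (x ^ p) \<in> pR"
  using assms(1,2)
proof (induction g)
  case 0
  then show ?case using prime_gt_0_nat[OF prime_p] by (simp add: zero_power)
next
  case (pCons a g)
  have g: "coeff g i \<in> R" "coeff g i \<in> \<rat>" for i
    using pCons.prems(1)[of "Suc i"] pCons.prems(2)[of "Suc i"] by simp_all
  have a: "a \<in> R" "a \<in> \<rat>" using pCons.prems(1)[of 0] pCons.prems(2)[of 0] by simp_all
  let ?y = "poly g x"
  have yR: "?y \<in> R" using g(1) assms(3) by (rule poly_R)
  have "poly (pCons a g) x ^ p - poly (pCons a g) (x ^ p)
     = ((a + x * ?y) ^ p - (a ^ p + (x * ?y) ^ p)) + (a ^ p - a) + x ^ p * (?y ^ p - poly g (x ^ p))"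
    by (simp add: algebra_simps power_mult_distrib)
  moreover have "(a + x * ?y) ^ p - (a ^ p + (x * ?y) ^ p) \<in> pR"
    using a yR assms(3) by (intro freshmans_dream_pR) simp_all
  moreover have "x ^ p * (?y ^ p - poly g (x ^ p)) \<in> pR"
    using pCons.IH[OF g] assms(3) by (intro pR_mult_left) simp_all
  ultimately show ?case using rat_fermat[OF a] pR_add by (simp only:)
qed

lemma coeff_mult_R:
  "(\<And>i. coeff f i \<in> R) \<Longrightarrow> (\<And>i. coeff g i \<in> R) \<Longrightarrow> coeff (f * g) i \<in> R"
  unfolding coeff_mult by (intro R_sum R_mult)

lemma coeff_prod_linear_R:
  "(\<And>\<sigma>. \<sigma> \<in> A \<Longrightarrow> f \<sigma> \<in> R) \<Longrightarrow> coeff (\<Prod>\<sigma>\<in>A. [:- f \<sigma>, 1:]) i \<in> R"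
proof (induction A arbitrary: i rule: infinite_finite_induct)
  case (insert \<sigma> A)
  have "coeff [:- f \<sigma>, 1:] j \<in> R" for j
    using insert.prems[of \<sigma>] by (auto simp: coeff_pCons split: nat.split)
  then have "coeff ([:- f \<sigma>, 1:] * (\<Prod>\<sigma>\<in>A. [:- f \<sigma>, 1:])) i \<in> R"
    using insert.IH insert.prems by (intro coeff_mult_R) auto
  then show ?case using insert.hyps by (simp only: prod.insert not_False_eq_True)
qed auto

end

text \<open>These conditions fail for finitely many primes only. A unit \<eta> makes all conjugates
  units and allows negative exponents; a unit \<open>diff_prod\<close> allows the factor introduced
  by \<open>lagrange\<close> to be divided out.\<close>

locale good_prime = p_local +
  assumes eta_R: "\<eta> \<in> R" "1 / \<eta> \<in> R" and diff_prod_R: "diff_prod \<in> R" "1 / diff_prod \<in> R"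
begin

lemma coeff_root_poly_R: "coeff root_poly i \<in> R"
  unfolding root_poly_def by (rule coeff_prod_linear_R) (simp add: R_Gal eta_R)

lemma coeff_lagrange_R: "x \<in> R \<Longrightarrow> coeff (lagrange x) i \<in> R"
  unfolding lagrange_def coeff_sum coeff_smult
  by (rule R_sum, rule R_mult, simp add: R_Gal, rule coeff_prod_linear_R, simp add: R_Gal eta_R)

text \<open>Finiteness of \<open>R\<close> modulo \<open>p\<close>: the code \<open>r x\<close>
  records the residues of the rational coefficients of \<open>lagrange x\<close>. Equal codes give
  \<open>(x - y) * diff_prod\<close> in \<open>pR\<close>, and \<open>diff_prod\<close> is a
  unit.\<close>

lemma finite_residues:
  obtains r :: "'a \<Rightarrow> nat \<Rightarrow> int" where "finite (r ` R)"
    "\<And>x y. x \<in> R \<Longrightarrow> y \<in> R \<Longrightarrow> r x = r y \<Longrightarrow> x - y \<in> pR"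
proof -
  let ?N = "card (Gal :: ('a \<Rightarrow> 'a) set)"
  have "\<forall>x\<in>R \<inter> \<rat>. \<exists>c. c \<in> {0..<int p} \<and> x - of_int c \<in> pR" using rat_residue by blast
  then obtain c where c: "\<And>x. x \<in> R \<Longrightarrow> x \<in> \<rat> \<Longrightarrow> c x \<in> {0..<int p} \<and> x - of_int (c x) \<in> pR"
    by (metis IntI)
  \<comment> \<open>The restriction to \<open>{..?N}\<close> places all codes in one finite
    extensional function space.\<close>
  define r where "r x = (\<lambda>i\<in>{..?N}. c (coeff (lagrange x) i))" for x
  have "r ` R \<subseteq> {..?N} \<rightarrow>\<^sub>E {0..<int p}"
  proof (rule image_subsetI)
    fix x assume "x \<in> R"
    then have "c (coeff (lagrange x) i) \<in> {0..<int p}" for i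
      using c[OF coeff_lagrange_R coeff_lagrange_rat] by blast
    then show "r x \<in> {..?N} \<rightarrow>\<^sub>E {0..<int p}" unfolding r_def restrict_PiE_iff by blast
  qed
  then have "finite (r ` R)" by (rule finite_subset) (intro finite_PiE, auto)
  moreover have "x - y \<in> pR" if xy: "x \<in> R" "y \<in> R" "r x = r y" for x y
  proof -
    have "coeff (lagrange x) i - coeff (lagrange y) i \<in> pR" if "i \<le> ?N" for i
    proof -
      have "c (coeff (lagrange x) i) = c (coeff (lagrange y) i)"
        using fun_cong[OF xy(3), of i] that by (simp add: r_def)
      moreover have "coeff (lagrange z) i - of_int (c (coeff (lagrange z) i)) \<in> pR" if "z \<in> R" for z
        using c[OF coeff_lagrange_R[OF that] coeff_lagrange_rat] by blast
      from pR_diff[OF this[OF xy(1)] this[OF xy(2)]] calculation show ?thesis by simp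
    qed
    then have "(\<Sum>i\<le>?N. (coeff (lagrange x) i - coeff (lagrange y) i) * \<eta> ^ i) \<in> pR"
      using eta_R by (intro pR_sum pR_mult_right R_power) auto
    moreover have "poly (lagrange z) \<eta> = (\<Sum>i\<le>?N. coeff (lagrange z) i * \<eta> ^ i)" for z
      unfolding poly_altdef
      by (rule sum.mono_neutral_left) (use degree_lagrange[of z] coeff_eq_0[of "lagrange z"] in auto)
    ultimately have "poly (lagrange x) \<eta> - poly (lagrange y) \<eta> \<in> pR"
      by (simp add: left_diff_distrib sum_subtractf)
    also have "poly (lagrange x) \<eta> - poly (lagrange y) \<eta> = (x - y) * diff_prod" by (simp add: poly_lagrange_eta algebra_simps)
    finally have "(x - y) * diff_prod * (1 / diff_prod) \<in> pR" using diff_prod_R by (intro pR_mult_right[of "(x - y) * diff_prod"])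
    then show ?thesis using diff_prod_nz by simp
  qed
  ultimately show ?thesis by (rule that)
qed

end

section \<open>Roots of unity and Frobenius elements\<close>

lemma algebraic_int_root_of_unity:
  assumes "\<zeta> \<in> roots_of_unity"
  shows "algebraic_int \<zeta>"
proof -
  from assms obtain m where m: "m > 0" "\<zeta> ^ m = 1" by (auto simp: roots_of_unity_def)
  show ?thesis
  proof (rule algebraic_int_root[of 1 "monom 1 m"])
    show "poly (monom 1 m) \<zeta> = 1" using m by (simp add: poly_monom)
    show "degree (monom (1::'a) m) > 0" using m by (simp add: degree_monom_eq)
    show "lead_coeff (monom (1::'a) m) = 1" using m by (simp add: degree_monom_eq)
  qed (auto simp: int_imp_algebraic_int)
qed

lemma one_root_of_unity: "1 \<in> roots_of_unity"
  by (auto simp: roots_of_unity_def)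

lemma roots_of_unity_mult: "x \<in> roots_of_unity \<Longrightarrow> y \<in> roots_of_unity \<Longrightarrow> x * y \<in> roots_of_unity"
proof -
  assume "x \<in> roots_of_unity" "y \<in> roots_of_unity"
  then obtain m k where "m > 0" "x ^ m = 1" "k > 0" "y ^ k = 1" by (auto simp: roots_of_unity_def)
  moreover from this have "x ^ (m * k) = 1" "y ^ (k * m) = 1" by (simp_all add: power_mult)
  ultimately have "(x * y) ^ (m * k) = 1" "m * k > 0"
    by (simp_all add: power_mult_distrib mult.commute[of m k])
  then show ?thesis unfolding roots_of_unity_def by blast
qed

lemma roots_of_unity_power_int: "x \<in> roots_of_unity \<Longrightarrow> x powi k \<in> roots_of_unity"
proof -
  assume "x \<in> roots_of_unity"
  then obtain m where m: "m > 0" "x ^ m = 1" by (auto simp: roots_of_unity_def)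
  have "(x powi k) ^ m = (x powi int m) powi k"
    by (simp only: power_int_of_nat[symmetric] power_int_mult[symmetric] mult.commute)
  then have "(x powi k) ^ m = 1" using m by simp
  then show ?thesis using m unfolding roots_of_unity_def by blast
qed

lemma roots_of_unity_nz: "x \<in> roots_of_unity \<Longrightarrow> x \<noteq> 0"
  by (auto simp: roots_of_unity_def zero_power)

lemma roots_of_unity_inverse: "x \<in> roots_of_unity \<Longrightarrow> 1 / x \<in> roots_of_unity"
  using roots_of_unity_power_int[of x "-1"] by (simp add: power_int_minus field_simps)

context p_local
begin

lemma R_root_of_unity: "\<zeta> \<in> roots_of_unity \<Longrightarrow> \<zeta> \<in> R"
  by (intro R_algebraic_int algebraic_int_root_of_unity)

text \<open>Expand \<open>0 = (\<Sum>i<l. \<xi> ^ i)\<close> for \<open>\<xi> = 1 + p x\<close>: modulo \<open>p\<close> it gives \<open>l = p\<close>, and then modulo \<open>p\<^sup>2\<close>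
  the contradiction that \<open>p\<^sup>2\<close> divides \<open>p\<close>.\<close>

lemma root_of_unity_prime_order_cong_one:
  assumes p3: "p \<ge> 3" and l: "Factorial_Ring.prime l" and z: "\<xi> ^ l = 1" "\<xi> - 1 \<in> pR"
  shows "\<xi> = 1"
proof (rule ccontr)
  assume nz: "\<xi> \<noteq> 1"
  from z(2) obtain x where x: "\<xi> - 1 = of_nat p * x" "x \<in> R" unfolding pR_def by (rule imageE)
  have "(\<xi> - 1) * (\<Sum>i<l. \<xi> ^ i) = \<xi> ^ l - 1" by (simp add: power_diff_1_eq)
  then have sum0: "(\<Sum>i<l. \<xi> ^ i) = 0" using nz z(1) by simp
  have xi: "\<xi> = 1 + of_nat p * x" using x(1) by (simp add: algebra_simps)
  then have xR: "\<xi> \<in> R" using x(2) by simp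
  have "(\<Sum>i<l. \<xi> ^ i - 1 ^ i) \<in> pR" by (intro pR_sum pR_power_diff z xR R_1)
  then have "- of_int (int l) \<in> pR" using sum0 by (simp add: sum_subtractf)
  then have "of_int (int l) \<in> pR" using pR_uminus[of "- of_int (int l)"] by simp
  then have "int p dvd int l" by (rule of_int_in_pR)
  then have lp: "l = p" using primes_dvd_imp_eq[OF prime_p l] by simp
  have "\<exists>y\<in>R. \<xi> ^ i = 1 + of_nat i * (of_nat p * x) + of_nat p ^ 2 * y" for i
  proof (induction i)
    case 0
    show ?case by (intro bexI[of _ 0]) auto
  next
    case (Suc i)
    then obtain y where y: "y \<in> R" "\<xi> ^ i = 1 + of_nat i * (of_nat p * x) + of_nat p ^ 2 * y" by blast
    have "\<xi> ^ Suc i = (1 + of_nat p * x) * \<xi> ^ i" using xi by simp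
    also have "\<dots> = 1 + of_nat (Suc i) * (of_nat p * x) + of_nat p ^ 2 * (y + of_nat i * x * x + of_nat p * x * y)"
      unfolding y(2) by (simp add: algebra_simps power2_eq_square)
    finally show ?case using x(2) y(1)
      by (intro bexI[of _ "y + of_nat i * x * x + of_nat p * x * y"]) simp_all
  qed
  then obtain y where y: "\<And>i. y i \<in> R" "\<And>i. \<xi> ^ i = 1 + of_nat i * (of_nat p * x) + of_nat p ^ 2 * y i"
    by metis
  \<comment> \<open>Here \<open>p \<ge> 3\<close> enters: for odd \<open>p\<close> the sum of all
    \<open>i < p\<close> is divisible by \<open>p\<close>. For \<open>p = 2\<close> the root -1 is
    congruent to 1.\<close>
  have "odd p" using p3 prime_p prime_odd_nat by force
  then obtain t where t: "p = 2 * t + 1" by (rule oddE)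
  have "2 * (\<Sum>i<p. i) = 2 * (p * t)" using t Sum_Ico_nat[of 0 p] by (simp add: lessThan_atLeast0)
  then have "(\<Sum>i<p. i) = p * t" by simp
  then have "of_nat (\<Sum>i<p. i) = (of_nat (p * t) :: 'a)" by (simp only:)
  then have t': "(\<Sum>i<p. of_nat i) = (of_nat p * of_nat t :: 'a)"
    by (simp only: of_nat_sum of_nat_mult)
  have "0 = (\<Sum>i<p. \<xi> ^ i)" using sum0 lp by simp
  also have "\<dots> = of_nat p + (\<Sum>i<p. of_nat i) * (of_nat p * x) + of_nat p ^ 2 * (\<Sum>i<p. y i)"
    unfolding y(2) by (simp add: sum.distrib sum_distrib_left sum_distrib_right)
  also have "\<dots> = of_nat p * (1 + of_nat p * (of_nat t * x + (\<Sum>i<p. y i)))"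
    unfolding t' by (simp add: algebra_simps power2_eq_square)
  finally have "1 + of_nat p * (of_nat t * x + (\<Sum>i<p. y i)) = 0"
    using prime_gt_0_nat[OF prime_p] by simp
  then have "1 = of_nat p * (- (of_nat t * x + (\<Sum>i<p. y i)))"
    by (simp only: mult_minus_right eq_neg_iff_add_eq_0)
  moreover have "of_nat p * (- (of_nat t * x + (\<Sum>i<p. y i))) \<in> pR"
    using x(2) y(1) by (intro pR_I R_uminus R_add R_mult R_sum) auto
  ultimately have "of_int 1 \<in> pR" by simp
  then have "int p dvd 1" by (rule of_int_in_pR)
  then show False using not_dvd_one by simp
qed

text \<open>The exponent loses one prime factor at a time: for \<open>m = l * k\<close> the power
  \<open>\<zeta> ^ k\<close> falls under the prime case, so already
  \<open>\<zeta> ^ k = 1\<close>.\<close>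

lemma root_of_unity_cong_one:
  assumes "p \<ge> 3" "m > 0" "\<zeta> ^ m = 1" "\<zeta> - 1 \<in> pR"
  shows "\<zeta> = 1"
  using assms(2,3)
proof (induction m rule: less_induct)
  case (less m)
  show ?case
  proof (cases "m = 1")
    case False
    then obtain l where l: "Factorial_Ring.prime l" "l dvd m" using prime_factor_nat by blast
    then obtain k where k: "m = l * k" by (elim dvdE)
    then have k0: "k > 0" "k < m" using less.prems(1) prime_gt_1_nat[OF l(1)] by auto
    have zR: "\<zeta> \<in> R" using pR_subset R_add[of "\<zeta> - 1" 1] assms(4) by auto
    have "(\<zeta> ^ k) ^ l = 1" using less.prems(2) k by (simp add: power_mult[symmetric] mult.commute)
    moreover have "\<zeta> ^ k - 1 \<in> pR" using pR_power_diff[OF assms(4) zR R_1, of k] by simp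
    ultimately have "\<zeta> ^ k = 1" using root_of_unity_prime_order_cong_one[OF assms(1) l(1)] by blast
    then show ?thesis using less.IH[OF k0(2,1)] by blast
  qed (use less.prems in simp)
qed

end

text \<open>Two roots of unity that are congruent modulo \<open>p\<close> have a quotient congruent
  to 1 and therefore coincide, so the finitely many codes of \<open>R\<close> separate them.\<close>

lemma (in good_prime) finite_roots_of_unity:
  assumes "p \<ge> 3"
  shows "finite (roots_of_unity :: 'a set)"
proof -
  obtain r :: "'a \<Rightarrow> nat \<Rightarrow> int" where r: "finite (r ` R)"
      "\<And>x y. x \<in> R \<Longrightarrow> y \<in> R \<Longrightarrow> r x = r y \<Longrightarrow> x - y \<in> pR"
    using finite_residues by blast
  show ?thesis
  proof (rule finite_imageD)
    show "finite (r ` roots_of_unity)"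
      by (rule finite_subset[OF _ r(1)]) (auto intro: R_root_of_unity)
    show "inj_on r roots_of_unity"
    proof (rule inj_onI)
      fix x y assume xy: "x \<in> roots_of_unity" "y \<in> roots_of_unity" "r x = r y"
      have "(x - y) * (1 / y) \<in> pR"
        using xy by (intro pR_mult_right r R_root_of_unity roots_of_unity_inverse)
      then have "x * (1 / y) - 1 \<in> pR" using roots_of_unity_nz[OF xy(2)] by (simp add: diff_divide_distrib)
      moreover have "x * (1 / y) \<in> roots_of_unity"
        using xy by (intro roots_of_unity_mult roots_of_unity_inverse)
      ultimately have "x * (1 / y) = 1"
        using root_of_unity_cong_one[OF assms] unfolding roots_of_unity_def by blast
      then show "x = y" using roots_of_unity_nz[OF xy(2)] by simp
    qed
  qed
qed

section \<open>Properties that hold at almost all primes\<close>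

context conjugates_independent
begin

text \<open>One integer denominator \<open>d\<close> of \<open>x\<close> serves for all primes, and
  a prime larger than \<open>\<bar>d\<bar>\<close> does not divide it.\<close>

lemma eventually_p_integral:
  "\<forall>\<^sub>F p in sequentially. Factorial_Ring.prime p \<longrightarrow> (x::'a) \<in> p_local.R p"
proof -
  obtain d :: int where d: "d \<noteq> 0" "algebraic_int (of_int d * x)"
    using algebraic_int_multiple[OF algebraic] by blast
  have "\<forall>\<^sub>F p in sequentially. p > nat \<bar>d\<bar>" by (rule eventually_gt_at_top)
  then show ?thesis
  proof eventually_elim
    case (elim p)
    show ?case
    proof
      assume "Factorial_Ring.prime p"
      then interpret p_local \<eta> p by unfold_locales
      have "\<not> int p dvd d" using dvd_imp_le_int[OF d(1), of "int p"] elim by auto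
      then have "of_int d * x / of_int d \<in> R" using d(2) by (intro R_I)
      then show "x \<in> R" using d(1) by simp
    qed
  qed
qed

lemma eventually_good_prime:
  "\<forall>\<^sub>F p in sequentially. Factorial_Ring.prime p \<longrightarrow> good_prime \<eta> p"
  using eventually_p_integral[of \<eta>] eventually_p_integral[of "1 / \<eta>"]
    eventually_p_integral[of diff_prod] eventually_p_integral[of "1 / diff_prod"]
proof eventually_elim
  case (elim p)
  show ?case
  proof
    assume p: "Factorial_Ring.prime p"
    then interpret p_local \<eta> p by unfold_locales
    show "good_prime \<eta> p" using elim p by unfold_locales auto
  qed
qed

text \<open>No prime occurs in the claim; one auxiliary good prime that is at least 3 is enough, and
  there are arbitrarily large primes.\<close>

lemma finite_roots_of_unity: "finite (roots_of_unity :: 'a set)"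
proof -
  obtain N where N: "\<And>p. p \<ge> N \<Longrightarrow> Factorial_Ring.prime p \<Longrightarrow> good_prime \<eta> p"
    using eventually_good_prime unfolding eventually_sequentially by blast
  obtain p where p: "Factorial_Ring.prime p" "p > N + 3" using bigger_prime by blast
  then interpret good_prime \<eta> p by (intro N) auto
  show ?thesis using p by (intro finite_roots_of_unity) simp
qed

end

section \<open>Prime ideals above \<open>p\<close>, their localisation, and Frobenius
  elements\<close>

locale good_prime_ideal = good_prime +
  fixes P :: "'a set"
  assumes P: "P \<in> primes_above p"
begin

lemma primeideal_P: "primeideal P ring_of_integers" and p_in_P: "of_nat p \<in> P"
  using P by (auto simp: primes_above_def)

lemma P_algebraic_int: "x \<in> P \<Longrightarrow> algebraic_int x"
proof -
  interpret primeideal P ring_of_integers by (rule primeideal_P)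
  show "x \<in> P \<Longrightarrow> algebraic_int x" using a_subset by (auto simp: ring_of_integers_def)
qed

lemma P_add: "x \<in> P \<Longrightarrow> y \<in> P \<Longrightarrow> x + y \<in> P"
proof -
  interpret primeideal P ring_of_integers by (rule primeideal_P)
  show "x \<in> P \<Longrightarrow> y \<in> P \<Longrightarrow> x + y \<in> P"
    using additive_subgroup.a_closed[OF is_additive_subgroup, of x y] by (simp add: ring_of_integers_def)
qed

lemma P_mult: "x \<in> P \<Longrightarrow> algebraic_int y \<Longrightarrow> y * x \<in> P"
proof -
  interpret primeideal P ring_of_integers by (rule primeideal_P)
  show "x \<in> P \<Longrightarrow> algebraic_int y \<Longrightarrow> y * x \<in> P"
    using I_l_closed[of x y] by (simp add: ring_of_integers_def)
qed

lemma P_prime: "algebraic_int x \<Longrightarrow> algebraic_int y \<Longrightarrow> x * y \<in> P \<Longrightarrow> x \<in> P \<or> y \<in> P"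
proof -
  interpret primeideal P ring_of_integers by (rule primeideal_P)
  show "algebraic_int x \<Longrightarrow> algebraic_int y \<Longrightarrow> x * y \<in> P \<Longrightarrow> x \<in> P \<or> y \<in> P"
    using I_prime[of x y] by (simp add: ring_of_integers_def)
qed

lemma one_notin_P: "1 \<notin> P"
proof
  assume "1 \<in> P"
  then have "carrier ring_of_integers = P"
    using P_mult[of 1] P_algebraic_int by (auto simp: ring_of_integers_def)
  then show False using primeideal.I_notcarr[OF primeideal_P] by simp
qed

lemma of_int_in_P_iff: "of_int k \<in> P \<longleftrightarrow> int p dvd k"
proof
  assume k: "of_int k \<in> P"
  show "int p dvd k"
  proof (rule ccontr)
    assume "\<not> int p dvd k"
    then have "coprime (int p) k" using prime_int_p by (intro prime_imp_coprime)
    then obtain u v where "u * int p + v * k = 1" by (metis bezout_int coprime_iff_gcd_eq_1)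
    then have "of_int u * of_nat p + of_int v * of_int k = (1::'a)"
      by (metis of_int_add of_int_mult of_int_of_nat_eq of_int_1)
    then show False
      using P_add[OF P_mult[OF p_in_P, of "of_int u"] P_mult[OF k, of "of_int v"]] one_notin_P
      by (simp add: int_imp_algebraic_int)
  qed
next
  assume "int p dvd k"
  then obtain j where "k = j * int p" by (metis dvdE mult.commute)
  then show "of_int k \<in> P" using P_mult[OF p_in_P, of "of_int j"] by (simp add: int_imp_algebraic_int)
qed

text \<open>The maximal ideal generated by \<open>P\<close> in the localisation \<open>R\<close>.\<close>

definition M :: "'a set" where
  "M = {a / of_int m | a m. a \<in> P \<and> \<not> int p dvd m}"

lemma M_I: "a \<in> P \<Longrightarrow> \<not> int p dvd m \<Longrightarrow> a / of_int m \<in> M"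
  by (auto simp: M_def)

lemma M_E:
  assumes "x \<in> M"
  obtains a m where "x = a / of_int m" "a \<in> P" "\<not> int p dvd m" "m \<noteq> 0"
  using assms by (auto simp: M_def)

lemma P_subset_M: "x \<in> P \<Longrightarrow> x \<in> M"
  using M_I[of x 1] not_dvd_one by simp

lemma M_subset: "M \<subseteq> R"
  by (auto elim!: M_E intro!: R_I P_algebraic_int)

lemma M_add: "x \<in> M \<Longrightarrow> y \<in> M \<Longrightarrow> x + y \<in> M"
proof (elim M_E)
  fix a m b k
  assume *: "x = a / of_int m" "a \<in> P" "\<not> int p dvd m" "m \<noteq> 0"
    "y = b / of_int k" "b \<in> P" "\<not> int p dvd k" "k \<noteq> 0"
  then have "x + y = (of_int k * a + of_int m * b) / of_int (m * k)" by (simp add: field_simps)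
  moreover have "of_int k * a + of_int m * b \<in> P"
    using *(2,6) by (intro P_add P_mult) (simp_all add: int_imp_algebraic_int)
  ultimately show "x + y \<in> M" using *(3,7) by (simp only: M_I not_dvd_mult not_False_eq_True)
qed

lemma M_mult_left: "x \<in> R \<Longrightarrow> y \<in> M \<Longrightarrow> x * y \<in> M"
proof (elim M_E R_E)
  fix a m b k
  assume *: "x = a / of_int m" "algebraic_int a" "\<not> int p dvd m" "m \<noteq> 0"
    "y = b / of_int k" "b \<in> P" "\<not> int p dvd k" "k \<noteq> 0"
  then have "x * y = (a * b) / of_int (m * k)" by simp
  then show "x * y \<in> M" using *(2,3,6,7) by (simp only: M_I P_mult not_dvd_mult not_False_eq_True)
qed

lemma M_mult_right: "y \<in> M \<Longrightarrow> x \<in> R \<Longrightarrow> y * x \<in> M"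
  using M_mult_left[of x y] by (simp add: mult.commute)

lemma M_0 [simp]: "0 \<in> M"
  using M_mult_left[OF R_0 P_subset_M[OF p_in_P]] by simp

lemma M_uminus: "x \<in> M \<Longrightarrow> - x \<in> M"
  using M_mult_left[of "-1" x] by simp

lemma M_diff: "x \<in> M \<Longrightarrow> y \<in> M \<Longrightarrow> x - y \<in> M"
  using M_add[of x "- y"] M_uminus[of y] by simp

lemma pR_subset_M: "x \<in> pR \<Longrightarrow> x \<in> M"
  unfolding pR_def by (elim imageE) (simp add: M_mult_right P_subset_M p_in_P)

text \<open>\<open>M\<close> meets the ring of integers in \<open>P\<close> only: a denominator
  \<open>m\<close> prime to \<open>p\<close> lies outside the prime ideal \<open>P\<close> and can
  be cancelled.\<close>

lemma M_algebraic_int: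
  assumes "algebraic_int x" "x \<in> M"
  shows "x \<in> P"
proof -
  from assms(2) obtain a m where am: "x = a / of_int m" "a \<in> P" "\<not> int p dvd m" "m \<noteq> 0" by (rule M_E)
  then have "x * of_int m \<in> P" by simp
  then show ?thesis using P_prime[OF assms(1), of "of_int m"] am(3) of_int_in_P_iff[of m]
    by (simp add: int_imp_algebraic_int)
qed

lemma one_notin_M: "1 \<notin> M"
  using M_algebraic_int[of 1] one_notin_P by (auto simp: int_imp_algebraic_int)

lemma M_prime:
  assumes "x \<in> R" "y \<in> R" "x * y \<in> M"
  shows "x \<in> M \<or> y \<in> M"
  using assms(1,2)
proof (elim R_E)
  fix a m b k
  assume *: "x = a / of_int m" "algebraic_int a" "\<not> int p dvd m" "m \<noteq> 0"
    "y = b / of_int k" "algebraic_int b" "\<not> int p dvd k" "k \<noteq> 0"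
  have "a * b = of_int (m * k) * (x * y)" using * by simp
  also have "\<dots> \<in> M" using assms(3) by (rule M_mult_left[OF R_of_int])
  finally have "a * b \<in> P" using * by (intro M_algebraic_int algebraic_int_mult)
  then have "a \<in> P \<or> b \<in> P" using * by (intro P_prime)
  then show ?thesis using * M_I by auto
qed

lemma M_prod:
  assumes "finite A" "\<And>i. i \<in> A \<Longrightarrow> f i \<in> R" "prod f A \<in> M"
  shows "\<exists>i\<in>A. f i \<in> M"
  using assms
proof (induction A rule: finite_induct)
  case empty
  then show ?case using one_notin_M by simp
next
  case (insert i A)
  have "prod f A \<in> R" using insert.prems(1) by (intro R_prod) auto
  then have "f i \<in> M \<or> prod f A \<in> M"
    using M_prime[of "f i" "prod f A"] insert.prems insert.hyps by simp
  then show ?case using insert.IH insert.prems(1) by auto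
qed

lemma M_power_diff:
  assumes "x - y \<in> M" "x \<in> R" "y \<in> R"
  shows "x ^ k - y ^ k \<in> M"
proof (induction k)
  case (Suc k)
  have "x ^ Suc k - y ^ Suc k = (x - y) * x ^ k + y * (x ^ k - y ^ k)" by (simp add: algebra_simps)
  then show ?case using Suc assms by (simp only:) (intro M_add M_mult_left[of y] M_mult_right R_power)
qed simp

lemma poly_diff_M:
  assumes "\<And>i. coeff g i \<in> R" "x - y \<in> M" "x \<in> R" "y \<in> R"
  shows "poly g x - poly g y \<in> M"
  using assms(1)
proof (induction g)
  case (pCons a g)
  have g: "coeff g i \<in> R" for i using pCons.prems[of "Suc i"] by simp
  have "poly (pCons a g) x - poly (pCons a g) y = (x - y) * poly g x + y * (poly g x - poly g y)"
    by (simp add: algebra_simps)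
  then show ?case using pCons.IH[OF g] assms(2,3,4) poly_R[OF g]
    by (simp only:) (intro M_add M_mult_left[of y] M_mult_right)
qed simp

text \<open>For \<open>g\<close> with rational p-integral coefficients,
  \<open>\<sigma> (poly g \<eta>) = poly g (\<sigma> \<eta>)\<close> is congruent to
  \<open>poly g (\<eta> ^ p)\<close> and so to \<open>poly g \<eta> ^ p\<close>. With
  \<open>g = lagrange x\<close> this covers all elements \<open>x * diff_prod\<close>, and
  \<open>diff_prod\<close> is then divided out.\<close>

lemma frobenius_exists:
  obtains \<sigma> where "\<sigma> \<in> Gal" "\<And>x. x \<in> R \<Longrightarrow> \<sigma> x - x ^ p \<in> M"
proof -
  have p0: "p > 0" using prime_p by (rule prime_gt_0_nat)
  have "poly root_poly \<eta> = 0"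
    unfolding root_poly_def poly_prod using finite_Gal by (intro prod_zero bexI[of _ id]) simp_all
  then have "0 - poly root_poly (\<eta> ^ p) \<in> M"
    using poly_frobenius[OF coeff_root_poly_R coeff_root_poly_rat eta_R(1)] p0
    by (intro pR_subset_M) (simp add: zero_power)
  then have "poly root_poly (\<eta> ^ p) \<in> M" using M_uminus[of "0 - poly root_poly (\<eta> ^ p)"] by simp
  then have "(\<Prod>\<sigma>\<in>Gal. \<eta> ^ p - \<sigma> \<eta>) \<in> M" by (simp add: root_poly_def poly_prod)
  then obtain \<sigma> where s: "\<sigma> \<in> Gal" "\<eta> ^ p - \<sigma> \<eta> \<in> M"
    using M_prod[OF finite_Gal, of "\<lambda>\<sigma>. \<eta> ^ p - \<sigma> \<eta>"] eta_R(1) R_Gal by auto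
  have lag: "\<sigma> (poly g \<eta>) - poly g \<eta> ^ p \<in> M"
    if g: "\<And>i. coeff g i \<in> R" "\<And>i. coeff g i \<in> \<rat>" for g
  proof -
    have "poly g (\<eta> ^ p) - poly g (\<sigma> \<eta>) \<in> M"
      using s eta_R(1) R_Gal by (intro poly_diff_M g) auto
    moreover have "poly g \<eta> ^ p - poly g (\<eta> ^ p) \<in> M"
      using g eta_R(1) by (intro pR_subset_M poly_frobenius)
    ultimately have "- ((poly g \<eta> ^ p - poly g (\<eta> ^ p)) + (poly g (\<eta> ^ p) - poly g (\<sigma> \<eta>))) \<in> M"
      by (intro M_uminus M_add[of "poly g \<eta> ^ p - poly g (\<eta> ^ p)"])
    then show ?thesis using Gal_poly_rat[OF s(1) g(2)] by simp
  qed
  have lag': "\<sigma> (x * diff_prod) - (x * diff_prod) ^ p \<in> M" if "x \<in> R" for x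
    using lag[of "lagrange x"] coeff_lagrange_R[OF that] coeff_lagrange_rat[of x]
    by (simp add: poly_lagrange_eta)
  have "\<sigma> x - x ^ p \<in> M" if x: "x \<in> R" for x
  proof -
    have "\<sigma> diff_prod - diff_prod ^ p \<in> M" using lag'[of 1] by simp
    then have "x ^ p * (\<sigma> diff_prod - diff_prod ^ p) \<in> M" using x by (intro M_mult_left) simp_all
    \<comment> \<open>Subtracting \<open>x ^ p\<close> times the congruence for
      \<open>diff_prod\<close> leaves a multiple of the unit
      \<open>\<sigma> diff_prod\<close>.\<close>
    from M_diff[OF lag'[OF x] this] have "(\<sigma> x - x ^ p) * \<sigma> diff_prod \<in> M"
      by (simp add: Gal_simps(4)[OF s(1)] power_mult_distrib algebra_simps)
    then have "(\<sigma> x - x ^ p) * \<sigma> diff_prod * \<sigma> (1 / diff_prod) \<in> M"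
      using R_Gal[OF s(1)] diff_prod_R by (intro M_mult_right[of "(\<sigma> x - x ^ p) * \<sigma> diff_prod"])
    then show ?thesis using diff_prod_nz
      by (simp add: Gal_simps(10)[OF s(1)] Gal_simps(2)[OF s(1)] Gal_simps(8)[OF s(1)])
  qed
  then show ?thesis using s(1) that by blast
qed

lemma frobenius_funpow:
  assumes "\<sigma> \<in> Gal" "\<And>x. x \<in> R \<Longrightarrow> \<sigma> x - x ^ p \<in> M" "x \<in> R"
  shows "(\<sigma> ^^ i) x - x ^ (p ^ i) \<in> M"
proof (induction i)
  case (Suc i)
  let ?y = "(\<sigma> ^^ i) x"
  have y: "?y \<in> R" using R_Gal[OF Gal_funpow[OF assms(1)]] assms(3) by blast
  have "?y ^ p - (x ^ (p ^ i)) ^ p \<in> M" using Suc y assms(3) by (intro M_power_diff) auto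
  with assms(2)[OF y] have "(\<sigma> ?y - ?y ^ p) + (?y ^ p - (x ^ (p ^ i)) ^ p) \<in> M" by (rule M_add)
  then show ?case by (simp add: power_mult[symmetric] mult.commute)
qed simp

end

section \<open>The residue field\<close>

lemma (in domain) finite_imp_field:
  assumes "finite (carrier R)"
  shows "Ring.field R"
proof (rule cring_fieldI2)
  show "\<zero> \<noteq> \<one>" using one_not_zero by simp
  fix a assume a: "a \<in> carrier R" "a \<noteq> \<zero>"
  have "inj_on ((\<otimes>) a) (carrier R)" using a by (auto intro!: inj_onI simp: m_lcancel)
  moreover have "(\<otimes>) a ` carrier R \<subseteq> carrier R" using a by auto
  ultimately have "(\<otimes>) a ` carrier R = carrier R" using assms by (intro endo_inj_surj)
  then show "\<exists>b\<in>carrier R. a \<otimes> b = \<one>" using one_closed by (metis imageE)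
qed

lemma (in domain) finite_subring_imp_subfield:
  assumes "subring K R" "finite K"
  shows "subfield K R"
proof (rule subfield_iff(1))
  interpret K: domain "R\<lparr>carrier := K\<rparr>" using assms(1) by (rule subring_is_domain)
  show "Ring.field (R\<lparr>carrier := K\<rparr>)" using assms(2) by (intro K.finite_imp_field) simp
  show "K \<subseteq> carrier R" using assms(1) by (rule subringE)
qed

lemma (in ring) card_dimension:
  assumes "subfield K R" "dimension n K E" "finite K"
  shows "card E = card K ^ n"
proof -
  obtain Us where Us: "set Us \<subseteq> carrier R" "independent K Us" "length Us = n" "Span K Us = E"
    using exists_base[OF assms(1,2)] by blast
  let ?L = "{Ks. set Ks \<subseteq> K \<and> length Ks = n}"
  have mem: "a \<in> E \<longleftrightarrow> (\<exists>Ks. set Ks \<subseteq> K \<and> length Ks = length Us \<and> a = combine Ks Us)" for a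
    using Span_mem_iff_length_version[OF assms(1) Us(1), of a] Us(4) by blast
  have "bij_betw (\<lambda>Ks. combine Ks Us) ?L E"
    unfolding bij_betw_def
  proof
    show "inj_on (\<lambda>Ks. combine Ks Us) ?L"
    proof (rule inj_onI)
      fix Ks Ls assume *: "Ks \<in> ?L" "Ls \<in> ?L" "combine Ks Us = combine Ls Us"
      have "combine Ks Us \<in> Span K Us" using mem[of "combine Ks Us"] * Us(3,4) by auto
      from unique_decomposition[OF assms(1) Us(2) this] show "Ks = Ls"
        by (rule ex1E) (use * Us(3) in \<open>metis (lifting) mem_Collect_eq\<close>)
    qed
    show "(\<lambda>Ks. combine Ks Us) ` ?L = E" using mem Us(3) by auto
  qed
  then have "card E = card ?L" by (simp add: bij_betw_same_card)
  then show ?thesis using card_lists_length_eq[OF assms(3)] by simp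
qed

lemma (in ring) card_carrier_eq_power_dim:
  assumes "subfield K R" "finite (carrier R)"
  shows "card (carrier R) = card K ^ dim K (carrier R)"
proof -
  have K: "K \<subseteq> carrier R" using assms(1) by (rule subfieldE)
  \<comment> \<open>The list of all elements is a spanning family, which gives finite dimension;
    only then does \<open>dim\<close> denote an actual dimension.\<close>
  obtain xs where xs: "set xs = carrier R" using finite_list[OF assms(2)] by blast
  have "Span K xs = carrier R"
  proof
    show "Span K xs \<subseteq> carrier R" using K xs by (intro Span_in_carrier) auto
    show "carrier R \<subseteq> Span K xs" using Span_base_incl[OF assms(1), of xs] xs by simp
  qed
  then have "finite_dimension K (carrier R)" using Span_finite_dimension[OF assms(1), of xs] xs by simp
  then have "dimension (dim K (carrier R)) K (carrier R)"
    using finite_dimensionE[OF assms(1)] by (simp add: over_def)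
  then show ?thesis using assms finite_subset[OF K] by (intro card_dimension)
qed

context good_prime_ideal
begin

definition residue :: "'a \<Rightarrow> 'a set" where
  "residue x = P +>\<^bsub>ring_of_integers\<^esub> x"

abbreviation F :: "'a set ring" where
  "F \<equiv> ring_of_integers Quot P"

lemma domain_F: "domain F"
  using primeideal_P by (rule primeideal.quotient_is_domain)

lemma residue_ring_hom: "residue \<in> ring_hom ring_of_integers F"
  using ideal.rcos_ring_hom[OF primeideal.axioms(1)[OF primeideal_P]] by (simp add: residue_def[abs_def])

lemma residue_closed: "algebraic_int x \<Longrightarrow> residue x \<in> carrier F"
  using ring_hom_closed[OF residue_ring_hom, of x] by (simp add: ring_of_integers_def)

lemma residue_mult: "algebraic_int x \<Longrightarrow> algebraic_int y \<Longrightarrow> residue (x * y) = residue x \<otimes>\<^bsub>F\<^esub> residue y"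
  using ring_hom_mult[OF residue_ring_hom, of x y] by (simp add: ring_of_integers_def)

lemma residue_add: "algebraic_int x \<Longrightarrow> algebraic_int y \<Longrightarrow> residue (x + y) = residue x \<oplus>\<^bsub>F\<^esub> residue y"
  using ring_hom_add[OF residue_ring_hom, of x y] by (simp add: ring_of_integers_def)

lemma residue_one: "residue 1 = \<one>\<^bsub>F\<^esub>"
  using ring_hom_one[OF residue_ring_hom] by (simp add: ring_of_integers_def)

lemma algebraic_int_power: "algebraic_int (x::'a) \<Longrightarrow> algebraic_int (x ^ k)"
  by (induction k) (auto simp: algebraic_int_mult int_imp_algebraic_int)

lemma residue_power: "algebraic_int x \<Longrightarrow> residue (x ^ k) = residue x [^]\<^bsub>F\<^esub> k"
proof (induction k)
  case 0
  then show ?case by (simp add: residue_one)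
next
  case (Suc k)
  interpret F: domain F by (rule domain_F)
  have "residue (x ^ k * x) = residue (x ^ k) \<otimes>\<^bsub>F\<^esub> residue x"
    using Suc.prems by (intro residue_mult algebraic_int_power)
  then show ?case using Suc by (simp add: mult.commute)
qed

lemma residue_eq_iff:
  assumes "algebraic_int x" "algebraic_int y"
  shows "residue x = residue y \<longleftrightarrow> x - y \<in> P"
proof -
  interpret O: cring "ring_of_integers :: 'a ring" by (rule integers_cring)
  have minus: "\<ominus>\<^bsub>ring_of_integers\<^esub> y = - y"
    using assms(2) by (intro O.minus_equality) (auto simp: ring_of_integers_def)
  have "x \<ominus>\<^bsub>ring_of_integers\<^esub> y = x - y"
    unfolding a_minus_def minus by (simp add: ring_of_integers_def)
  then show ?thesis
    using O.quotient_eq_iff_same_a_r_cos[OF primeideal.axioms(1)[OF primeideal_P], of x y] assms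
    by (simp add: residue_def ring_of_integers_def)
qed

lemma carrier_F: "carrier F = residue ` {x. algebraic_int x}"
  by (auto simp: FactRing_def A_RCOSETS_def' residue_def ring_of_integers_def)

lemma residue_zero: "residue 0 = \<zero>\<^bsub>F\<^esub>"
proof -
  interpret F: domain F by (rule domain_F)
  have "residue 0 \<oplus>\<^bsub>F\<^esub> residue 0 = residue 0" using residue_add[of 0 0] by simp
  then show ?thesis using residue_closed[of 0] F.add.r_cancel_one' by auto
qed

lemma residue_zero_iff: "algebraic_int x \<Longrightarrow> residue x = \<zero>\<^bsub>F\<^esub> \<longleftrightarrow> x \<in> P"
  using residue_eq_iff[of x 0] residue_zero by simp

text \<open>Algebraic integers with the same code are congruent modulo \<open>p\<close>, hence
  modulo \<open>P\<close>; choosing one representative for each code reaches all residues.\<close>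

lemma finite_F: "finite (carrier F)"
proof -
  let ?O = "{x::'a. algebraic_int x}"
  obtain r :: "'a \<Rightarrow> nat \<Rightarrow> int" where r: "finite (r ` R)"
      "\<And>x y. x \<in> R \<Longrightarrow> y \<in> R \<Longrightarrow> r x = r y \<Longrightarrow> x - y \<in> pR"
    using finite_residues by blast
  have same: "residue x = residue y" if "algebraic_int x" "algebraic_int y" "r x = r y" for x y
  proof -
    have "x - y \<in> pR" using that by (intro r R_algebraic_int)
    moreover have "algebraic_int (x - y)" using that algebraic_int_add[of x "- y"] by simp
    ultimately have "x - y \<in> P" by (intro M_algebraic_int pR_subset_M)
    then show ?thesis using that by (simp add: residue_eq_iff)
  qed
  have "residue x \<in> (\<lambda>v. residue (inv_into ?O r v)) ` (r ` ?O)" if x: "x \<in> ?O" for x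
  proof (rule image_eqI[of _ _ "r x"])
    have rx: "r x \<in> r ` ?O" using x by (rule imageI)
    have "inv_into ?O r (r x) \<in> ?O" using rx by (rule inv_into_into)
    moreover have "r (inv_into ?O r (r x)) = r x" using rx by (rule f_inv_into_f)
    ultimately show "residue x = residue (inv_into ?O r (r x))" using x by (intro same) simp_all
    show "r x \<in> r ` ?O" by (rule rx)
  qed
  then have "carrier F \<subseteq> (\<lambda>v. residue (inv_into ?O r v)) ` (r ` ?O)"
    unfolding carrier_F by (rule image_subsetI)
  moreover have "r ` ?O \<subseteq> r ` R" using R_algebraic_int by (intro image_mono) blast
  ultimately show ?thesis using r(1) finite_subset by (metis finite_imageI)
qed

text \<open>The scalar field over which \<open>residue_degree\<close> takes the dimension.\<close>

definition prime_field :: "'a set set" where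
  "prime_field = range (\<lambda>m::int. residue (of_int m))"

lemma residue_of_int_eq_iff: "residue (of_int i) = residue (of_int j) \<longleftrightarrow> int p dvd i - j"
  using residue_eq_iff[of "of_int i" "of_int j"] of_int_in_P_iff[of "i - j"]
  by (simp add: int_imp_algebraic_int)

lemma card_prime_field: "card prime_field = p"
proof -
  have p0: "int p > 0" using prime_gt_0_nat[OF prime_p] by simp
  have "residue (of_int m) = residue (of_int (m mod int p))" for m
    by (simp add: residue_of_int_eq_iff minus_mod_eq_mult_div)
  then have "prime_field = (\<lambda>m. residue (of_int m)) ` {0..<int p}"
    unfolding prime_field_def using p0
    by (auto intro!: image_eqI[of _ _ "_ mod int p"])
  moreover have "inj_on (\<lambda>m. residue (of_int m)) {0..<int p}"
  proof (rule inj_onI)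
    fix i j assume ij: "i \<in> {0..<int p}" "j \<in> {0..<int p}" "residue (of_int i) = residue (of_int j)"
    then have "i mod int p = j mod int p" by (simp only: residue_of_int_eq_iff mod_eq_dvd_iff)
    then show "i = j" using ij by simp
  qed
  ultimately show ?thesis by (simp add: card_image)
qed

lemma subring_prime_field: "subring prime_field F"
proof -
  interpret F: domain F by (rule domain_F)
  have ai [simp]: "algebraic_int (of_int m :: 'a)" for m by (simp add: int_imp_algebraic_int)
  show ?thesis
  proof (rule F.subringI)
    show "prime_field \<subseteq> carrier F" by (auto simp: prime_field_def residue_closed)
    show "\<one>\<^bsub>F\<^esub> \<in> prime_field" unfolding prime_field_def using residue_one by (intro range_eqI[of _ _ 1]) simp
    fix h1 h2 assume "h1 \<in> prime_field" "h2 \<in> prime_field"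
    then obtain i j where ij: "h1 = residue (of_int i)" "h2 = residue (of_int j)"
      by (auto simp: prime_field_def)
    have "h1 \<otimes>\<^bsub>F\<^esub> h2 = residue (of_int (i * j))" "h1 \<oplus>\<^bsub>F\<^esub> h2 = residue (of_int (i + j))"
      unfolding ij by (simp_all add: residue_mult residue_add)
    then show "h1 \<otimes>\<^bsub>F\<^esub> h2 \<in> prime_field" "h1 \<oplus>\<^bsub>F\<^esub> h2 \<in> prime_field"
      unfolding prime_field_def by blast+
  next
    fix h assume "h \<in> prime_field"
    then obtain i where i: "h = residue (of_int i)" by (auto simp: prime_field_def)
    have "residue (of_int (- i)) \<oplus>\<^bsub>F\<^esub> h = \<zero>\<^bsub>F\<^esub>"
      using residue_add[of "of_int (- i)" "of_int i"] i residue_zero by simp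
    then have "\<ominus>\<^bsub>F\<^esub> h = residue (of_int (- i))"
      using i by (intro F.minus_equality) (auto intro: residue_closed simp del: of_int_minus)
    then show "\<ominus>\<^bsub>F\<^esub> h \<in> prime_field" unfolding prime_field_def by blast
  qed
qed

lemma card_F: "card (carrier F) = p ^ residue_degree P"
proof -
  interpret F: domain F by (rule domain_F)
  have "finite prime_field"
    using finite_subset[OF subringE(1)[OF subring_prime_field] finite_F] .
  then have "subfield prime_field F" by (intro F.finite_subring_imp_subfield subring_prime_field)
  from F.card_carrier_eq_power_dim[OF this finite_F] card_prime_field
  show ?thesis by (simp add: residue_degree_def prime_field_def residue_def)
qed

lemma residue_field_fermat:
  assumes "algebraic_int x" "x \<notin> P"
  shows "x ^ (p ^ residue_degree P - 1) - 1 \<in> P"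
proof -
  interpret F: domain F by (rule domain_F)
  interpret F: Ring.field F using finite_F by (rule F.finite_imp_field)
  interpret G: group "mult_of F" by (rule F.field_mult_group)
  have nz: "residue x \<in> carrier (mult_of F)"
    using assms residue_closed[of x] residue_zero_iff[of x] by (simp add: carrier_mult_of)
  have "residue x [^]\<^bsub>mult_of F\<^esub> Coset.order (mult_of F) = \<one>\<^bsub>mult_of F\<^esub>"
    using nz by (rule G.pow_order_eq_1)
  moreover have "Coset.order (mult_of F) = p ^ residue_degree P - 1"
    using F.order_mult_of[OF finite_F] card_F by (simp add: Coset.order_def)
  ultimately have "residue x [^]\<^bsub>F\<^esub> (p ^ residue_degree P - 1) = \<one>\<^bsub>F\<^esub>"
    by (simp add: nat_pow_mult_of)
  then have "residue (x ^ (p ^ residue_degree P - 1)) = residue 1"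
    using assms(1) by (simp add: residue_power residue_one)
  then show ?thesis using assms(1) by (subst (asm) residue_eq_iff) (auto simp: algebraic_int_power int_imp_algebraic_int)
qed

lemma residue_degree_le:
  assumes "m > 0" "\<And>x. algebraic_int x \<Longrightarrow> x ^ (p ^ m) - x \<in> P"
  shows "residue_degree P \<le> m"
proof -
  interpret F: domain F by (rule domain_F)
  \<comment> \<open>Roots are counted for \<open>X ^ (p ^ m - 1) - 1\<close> on the nonzero
    residues; \<open>m > 0\<close> makes this exponent nonzero.\<close>
  let ?d = "p ^ m - 1"
  have p1: "p > 1" using prime_p by (rule prime_gt_1_nat)
  have d: "?d \<noteq> 0" "Suc ?d = p ^ m" using one_less_power[OF p1 assms(1)] by auto
  have "a [^]\<^bsub>F\<^esub> ?d = \<one>\<^bsub>F\<^esub>" if a: "a \<in> carrier F" "a \<noteq> \<zero>\<^bsub>F\<^esub>" for a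
  proof -
    from a(1) obtain x where x: "algebraic_int x" "a = residue x" by (auto simp: carrier_F)
    have "residue (x ^ (p ^ m)) = residue x"
      using assms(2)[OF x(1)] x(1) by (simp add: residue_eq_iff algebraic_int_power)
    then have "a [^]\<^bsub>F\<^esub> Suc ?d = a" using x d(2) by (simp add: residue_power)
    then have "a [^]\<^bsub>F\<^esub> ?d \<otimes>\<^bsub>F\<^esub> a = \<one>\<^bsub>F\<^esub> \<otimes>\<^bsub>F\<^esub> a" using a by simp
    then show ?thesis using a by (subst (asm) F.m_rcancel) auto
  qed
  then have "carrier F - {\<zero>\<^bsub>F\<^esub>} \<subseteq> {a \<in> carrier F. a [^]\<^bsub>F\<^esub> ?d = \<one>\<^bsub>F\<^esub>}" by blast
  then have "card (carrier F - {\<zero>\<^bsub>F\<^esub>}) \<le> card {a \<in> carrier F. a [^]\<^bsub>F\<^esub> ?d = \<one>\<^bsub>F\<^esub>}"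
    using finite_F by (intro card_mono) auto
  also have "\<dots> \<le> ?d" using F.num_roots_le_deg[OF finite_F d(1)] .
  finally have "p ^ residue_degree P - 1 \<le> ?d" using card_F finite_F by (simp add: card_Diff_singleton)
  then have "p ^ residue_degree P \<le> p ^ m" using d by linarith
  then show ?thesis using p1 by (rule power_le_imp_le_exp[rotated])
qed

text \<open>\<eta> need not be an algebraic integer, whereas the residue field is built from
  algebraic integers. Fermat is therefore applied to a numerator and a denominator of \<eta>
  separately; the numerator is outside \<open>P\<close> because \<open>1 / \<eta>\<close> is
  p-integral.\<close>

lemma eta_fermat: "\<eta> ^ (p ^ residue_degree P - 1) - 1 \<in> M"
proof -
  let ?N = "p ^ residue_degree P - 1"
  from eta_R(1) obtain a m where am: "\<eta> = a / of_int m" "algebraic_int a" "\<not> int p dvd m" "m \<noteq> 0"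
    by (rule R_E)
  have "a \<notin> P"
  proof
    assume "a \<in> P"
    then have "\<eta> \<in> M" using am by (simp add: M_I)
    then have "\<eta> * (1 / \<eta>) \<in> M" using eta_R(2) by (intro M_mult_right)
    then show False using eta_nz one_notin_M by simp
  qed
  then have "a ^ ?N - 1 \<in> P" using am(2) by (intro residue_field_fermat)
  moreover have "of_int m ^ ?N - 1 \<in> P"
    using am(3) of_int_in_P_iff[of m] by (intro residue_field_fermat) (auto simp: int_imp_algebraic_int)
  ultimately have "(a ^ ?N - 1) - (of_int m ^ ?N - 1) \<in> M" by (intro M_diff P_subset_M)
  moreover have "\<not> int p dvd m ^ ?N" using am(3) prime_int_p prime_dvd_power by blast
  then have "1 / of_int (m ^ ?N) \<in> R" by (rule R_inverse_int)
  ultimately have "((a ^ ?N - 1) - (of_int m ^ ?N - 1)) * (1 / of_int (m ^ ?N)) \<in> M"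
    by (rule M_mult_right)
  also have "((a ^ ?N - 1) - (of_int m ^ ?N - 1)) * (1 / of_int (m ^ ?N)) = \<eta> ^ ?N - 1"
    unfolding am(1) using am(4) by (simp add: power_divide field_simps)
  finally show ?thesis .
qed

end

section \<open>Cyclotomic polynomials\<close>

lemma map_poly_of_int_mult:
  "map_poly of_int (f * g) = (map_poly of_int f * map_poly of_int g :: 'b::comm_ring_1 poly)"
  by (intro poly_eqI) (simp add: coeff_map_poly coeff_mult)

lemma map_poly_of_int_prod:
  "map_poly of_int (prod f A) = (\<Prod>i\<in>A. map_poly of_int (f i) :: 'b::comm_ring_1 poly)"
  by (induction A rule: infinite_finite_induct) (simp_all add: map_poly_of_int_mult)

lemma map_poly_of_int_inj:
  "map_poly of_int f = (map_poly of_int g :: 'b::ring_char_0 poly) \<Longrightarrow> f = g"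
  by (auto simp: poly_eq_iff coeff_map_poly)

lemma degree_map_poly_of_int [simp]: "degree (map_poly of_int f :: 'b::ring_char_0 poly) = degree f"
  by (rule degree_map_poly) simp

text \<open>Division with remainder by a monic polynomial stays integral. Over the larger ring the
  remainder is a multiple of \<open>b\<close> of smaller degree, so it vanishes and the integral
  quotient is \<open>c\<close>.\<close>

lemma monic_int_poly_quotient:
  assumes "lead_coeff b = 1" "map_poly of_int a = map_poly of_int b * (c :: 'b::{idom,ring_char_0} poly)"
  obtains q :: "int poly" where "map_poly of_int q = c"
proof -
  have b: "b \<noteq> 0" using assms(1) by auto
  \<comment> \<open>\<open>pseudo_divmod\<close> scales the dividend by a power of the leading
    coefficient of \<open>b\<close>, which is 1 here.\<close>
  obtain q r where qr: "pseudo_divmod a b = (q, r)" by (cases "pseudo_divmod a b")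
  from pseudo_divmod[OF b qr] assms(1) have a: "a = b * q + r" and r: "r = 0 \<or> degree r < degree b"
    by simp_all
  let ?m = "map_poly of_int :: int poly \<Rightarrow> 'b poly"
  have "?m a = ?m b * ?m q + ?m r"
    unfolding a by (intro poly_eqI) (simp add: coeff_map_poly map_poly_of_int_mult[symmetric])
  then have eq: "?m r = ?m b * (c - ?m q)" using assms(2) by (simp add: algebra_simps)
  have "c - ?m q = 0"
  proof (rule ccontr)
    assume nz: "c - ?m q \<noteq> 0"
    have "?m b \<noteq> 0" using b map_poly_of_int_inj[of b 0, where 'b='b] by auto
    then have "degree (?m r) = degree (?m b) + degree (c - ?m q)" "?m r \<noteq> 0"
      unfolding eq using nz by (simp_all add: degree_mult_eq)
    then show False using r by auto
  qed
  then show ?thesis using that[of q] by simp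
qed

text \<open>The product under the \<open>THE\<close> in \<open>cyclotomic_poly\<close>. That
  description denotes the intended polynomial only once this product is known to have integer
  coefficients.\<close>

definition cyclotomic_complex :: "nat \<Rightarrow> complex poly" where
  "cyclotomic_complex d = (\<Prod>\<omega>\<in>primitive_roots_of_unity d. [:- \<omega>, 1:])"

lemma roots_of_unity_eq_Union:
  assumes "h > 0"
  shows "{z::complex. z ^ h = 1} = (\<Union>d\<in>{d. d dvd h}. primitive_roots_of_unity d)"
proof
  show "(\<Union>d\<in>{d. d dvd h}. primitive_roots_of_unity d) \<subseteq> {z. z ^ h = 1}"
    by (auto simp: primitive_roots_of_unity_def elim!: dvdE simp: power_mult)
  show "{z::complex. z ^ h = 1} \<subseteq> (\<Union>d\<in>{d. d dvd h}. primitive_roots_of_unity d)"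
  proof
    fix z :: complex assume "z \<in> {z. z ^ h = 1}"
    then have z: "z ^ h = 1" by simp
    define d where "d = (LEAST k. k > 0 \<and> z ^ k = 1)"
    have d: "d > 0" "z ^ d = 1" using LeastI[of "\<lambda>k. k > 0 \<and> z ^ k = 1" h] assms z by (auto simp: d_def)
    have min: "z ^ k \<noteq> 1" if "0 < k" "k < d" for k
      using not_less_Least[of k "\<lambda>k. k > 0 \<and> z ^ k = 1"] that by (auto simp: d_def)
    have "z ^ h = z ^ (d * (h div d) + h mod d)" by simp
    also have "\<dots> = z ^ (h mod d)" using d(2) by (simp only: power_add power_mult power_one mult_1)
    finally have "h mod d = 0" using z min[of "h mod d"] d(1) by auto
    then have "d dvd h" by (rule mod_0_imp_dvd)
    then show "z \<in> (\<Union>d\<in>{d. d dvd h}. primitive_roots_of_unity d)"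
      using d min by (auto simp: primitive_roots_of_unity_def)
  qed
qed

lemma finite_primitive_roots_of_unity:
  assumes "d > 0"
  shows "finite (primitive_roots_of_unity d)"
proof (rule finite_subset)
  show "primitive_roots_of_unity d \<subseteq> {z. z ^ d = 1}" by (auto simp: primitive_roots_of_unity_def)
  show "finite {z::complex. z ^ d = 1}" using assms by (intro finite_roots_unity) simp
qed

text \<open>\<open>X ^ h - 1\<close> has no multiple root, so it is the product over its roots,
  grouped by their exact orders.\<close>

lemma monom_minus_one_eq_prod_cyclotomic:
  assumes "h > 0"
  shows "monom 1 h - 1 = (\<Prod>d\<in>{d. d dvd h}. cyclotomic_complex d)"
proof -
  let ?f = "monom 1 h - 1 :: complex poly"
  have roots: "poly ?f z = 0 \<longleftrightarrow> z ^ h = 1" for z by (simp add: poly_monom)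
  have deg: "degree ?f = h"
    by (intro antisym degree_le le_degree) (use assms in \<open>auto simp: coeff_eq_0\<close>)
  have lead: "lead_coeff ?f = 1" unfolding deg using assms by simp
  have "rsquarefree ?f"
    unfolding rsquarefree_roots
  proof (intro allI notI)
    fix a assume a: "poly ?f a = 0 \<and> poly (pderiv ?f) a = 0"
    then have "a ^ h = 1" "of_nat h * a ^ (h - 1) = 0"
      by (simp_all add: poly_monom pderiv_diff pderiv_monom)
    then show False using assms by (auto simp: zero_power)
  qed
  from complex_poly_decompose_rsquarefree[OF this]
  have "?f = (\<Prod>z\<in>{z. z ^ h = 1}. [:- z, 1:])" unfolding lead roots by simp
  also have "\<dots> = (\<Prod>d\<in>{d. d dvd h}. cyclotomic_complex d)"
    unfolding roots_of_unity_eq_Union[OF assms] cyclotomic_complex_def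
  proof (rule prod.UNION_disjoint)
    show "finite {d. d dvd h}" using assms by simp
    show "\<forall>d\<in>{d. d dvd h}. finite (primitive_roots_of_unity d)"
      using assms dvd_pos_nat by (auto intro!: finite_primitive_roots_of_unity)
    have "\<not> d < e" if "d dvd h" "z \<in> primitive_roots_of_unity d" "z \<in> primitive_roots_of_unity e" for d e z
      using that assms dvd_pos_nat[of h d] by (auto simp: primitive_roots_of_unity_def)
    then show "\<forall>i\<in>{d. d dvd h}. \<forall>j\<in>{d. d dvd h}. i \<noteq> j \<longrightarrow>
        primitive_roots_of_unity i \<inter> primitive_roots_of_unity j = {}"
      by (auto, metis linorder_neqE_nat)
  qed
  finally show ?thesis .
qed

lemma lead_coeff_cyclotomic_complex: "lead_coeff (cyclotomic_complex d) = 1"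
  by (simp add: cyclotomic_complex_def lead_coeff_prod)

text \<open>Induction on \<open>d\<close>: the factors of \<open>X ^ d - 1\<close> for proper
  divisors multiply to a monic integer polynomial, so the remaining factor is an integral
  quotient.\<close>

lemma cyclotomic_complex_integral:
  "d > 0 \<Longrightarrow> \<exists>q::int poly. map_poly of_int q = cyclotomic_complex d"
proof (induction d rule: less_induct)
  case (less d)
  let ?E = "{e. e dvd d} - {d}"
  have E: "e < d \<and> e > 0" if "e \<in> ?E" for e
  proof -
    have e: "e dvd d" "e \<noteq> d" using that by auto
    then show ?thesis using dvd_imp_le[OF e(1) less.prems] dvd_pos_nat[OF less.prems e(1)] by simp
  qed
  then have "\<forall>e\<in>?E. \<exists>q::int poly. map_poly of_int q = cyclotomic_complex e" using less.IH by blast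
  then obtain q :: "nat \<Rightarrow> int poly" where q: "\<And>e. e \<in> ?E \<Longrightarrow> map_poly of_int (q e) = cyclotomic_complex e"
    by metis
  have lead: "lead_coeff (q e) = 1" if "e \<in> ?E" for e
  proof -
    have "of_int (lead_coeff (q e)) = lead_coeff (cyclotomic_complex e)"
      unfolding q[OF that, symmetric] by (simp add: coeff_map_poly)
    then show ?thesis by (simp add: lead_coeff_cyclotomic_complex)
  qed
  have "map_poly of_int (monom 1 d - 1) = (monom 1 d - 1 :: complex poly)"
    by (intro poly_eqI) (simp add: coeff_map_poly coeff_1)
  also have "\<dots> = (\<Prod>e\<in>?E. cyclotomic_complex e) * cyclotomic_complex d"
    unfolding monom_minus_one_eq_prod_cyclotomic[OF less.prems]
    using less.prems by (subst prod.remove[of _ d]) (simp_all add: mult.commute)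
  also have "(\<Prod>e\<in>?E. cyclotomic_complex e) = map_poly of_int (\<Prod>e\<in>?E. q e)"
    unfolding map_poly_of_int_prod by (intro prod.cong refl) (simp only: q)
  finally have "map_poly of_int (monom 1 d - 1) = map_poly of_int (\<Prod>e\<in>?E. q e) * cyclotomic_complex d" .
  moreover have "lead_coeff (\<Prod>e\<in>?E. q e) = 1" unfolding lead_coeff_prod using lead by simp
  ultimately show ?case using monic_int_poly_quotient[of "\<Prod>e\<in>?E. q e"] by metis
qed

lemma map_poly_cyclotomic_poly:
  assumes "d > 0"
  shows "map_poly of_int (cyclotomic_poly d) = cyclotomic_complex d"
proof -
  obtain q :: "int poly" where q: "map_poly of_int q = cyclotomic_complex d"
    using cyclotomic_complex_integral[OF assms] by blast
  then have "cyclotomic_poly d = q"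
    unfolding cyclotomic_poly_def cyclotomic_complex_def[symmetric]
    by (intro the_equality) (auto intro: map_poly_of_int_inj[where 'b=complex])
  then show ?thesis using q by simp
qed

text \<open>\<open>cis (2 * pi / d)\<close> is primitive because the numbers
  \<open>cis (2 * pi * k / d)\<close> with \<open>k < d\<close> are distinct. This makes the
  cyclotomic polynomials nonconstant.\<close>

lemma primitive_roots_of_unity_nonempty:
  assumes "d > 0"
  shows "primitive_roots_of_unity d \<noteq> {}"
proof (cases "d = 1")
  case True
  then have "1 \<in> primitive_roots_of_unity d" by (auto simp: primitive_roots_of_unity_def)
  then show ?thesis by blast
next
  case False
  let ?f = "\<lambda>k. cis (2 * pi * real k / real d)"
  have bij: "bij_betw ?f {..<d} {z. z ^ d = 1}" using assms by (rule bij_betw_roots_unity)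
  have pow: "?f 1 ^ k = ?f k" for k by (simp add: Complex.DeMoivre mult.commute)
  have "?f 1 ^ k \<noteq> 1" if k: "0 < k" "k < d" for k
  proof
    assume "?f 1 ^ k = 1"
    then have "?f k = ?f 0" unfolding pow by simp
    then show False using bij_betw_imp_inj_on[OF bij] k inj_onD[of ?f "{..<d}" k 0] by simp
  qed
  moreover have "?f 1 ^ d = 1" unfolding pow using assms by simp
  ultimately have "?f 1 \<in> primitive_roots_of_unity d" by (simp add: primitive_roots_of_unity_def)
  then show ?thesis by blast
qed

text \<open>\<open>A\<close> is the product of the other cyclotomic factors of
  \<open>X ^ h - 1\<close>. Its degree stays strictly below \<open>h\<close> because the omitted
  factor is nonconstant; so its coefficients can serve as exponents of \<open>h\<close> distinct
  conjugates.\<close>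

lemma cyclotomic_cofactor:
  assumes "h > 0" "\<delta> dvd h"
  obtains A :: "int poly" where "A * cyclotomic_poly \<delta> = monom 1 h - 1" "A \<noteq> 0" "degree A < h"
proof -
  have \<delta>: "\<delta> > 0" using assms by (rule dvd_pos_nat)
  let ?E = "{e. e dvd h} - {\<delta>}"
  define A where "A = (\<Prod>e\<in>?E. cyclotomic_poly e)"
  have "map_poly of_int A = (\<Prod>e\<in>?E. cyclotomic_complex e)"
    unfolding A_def map_poly_of_int_prod
    using assms(1) dvd_pos_nat by (intro prod.cong refl map_poly_cyclotomic_poly) auto
  then have "map_poly of_int (A * cyclotomic_poly \<delta>) = (\<Prod>e\<in>{e. e dvd h}. cyclotomic_complex e)"
    unfolding map_poly_of_int_mult map_poly_cyclotomic_poly[OF \<delta>]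
    using assms by (subst prod.remove[of _ \<delta>]) (simp_all add: mult.commute)
  also have "\<dots> = map_poly of_int (monom 1 h - 1)"
    unfolding monom_minus_one_eq_prod_cyclotomic[OF assms(1), symmetric]
    by (intro poly_eqI) (simp add: coeff_map_poly coeff_1)
  finally have eq: "A * cyclotomic_poly \<delta> = monom 1 h - 1" by (rule map_poly_of_int_inj)
  have deg: "degree (monom 1 h - 1 :: int poly) = h"
    by (intro antisym degree_le le_degree) (use assms(1) in \<open>auto simp: coeff_eq_0\<close>)
  then have nz: "A * cyclotomic_poly \<delta> \<noteq> 0" using eq assms(1) by auto
  have "degree (cyclotomic_poly \<delta>) = degree (cyclotomic_complex \<delta>)"
    using map_poly_cyclotomic_poly[OF \<delta>] by (metis degree_map_poly_of_int)
  also have "\<dots> = card (primitive_roots_of_unity \<delta>)"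
    unfolding cyclotomic_complex_def by (subst degree_prod_eq_sum_degree) auto
  also have "\<dots> > 0"
    using primitive_roots_of_unity_nonempty[OF \<delta>] finite_primitive_roots_of_unity[OF \<delta>] by (simp add: card_gt_0_iff)
  finally have "degree (cyclotomic_poly \<delta>) > 0" .
  moreover have "degree A + degree (cyclotomic_poly \<delta>) = h"
    using nz eq deg by (metis degree_mult_eq mult_eq_0_iff)
  moreover have "A \<noteq> 0" using nz by auto
  ultimately show ?thesis using that[OF eq] by linarith
qed

lemma D_quot_eq:
  assumes "A * cyclotomic_poly \<delta> = monom 1 h - 1" "h > 0" "p \<ge> 2"
  shows "D_quot h \<delta> p = poly A (int p)"
proof -
  have "poly (A * cyclotomic_poly \<delta>) (int p) = int p ^ h - 1" unfolding assms(1) by (simp add: poly_monom)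
  then have eq: "int p ^ h - 1 = poly A (int p) * poly (cyclotomic_poly \<delta>) (int p)" by simp
  \<comment> \<open>A nonzero \<open>p ^ h - 1\<close> forces a nonzero divisor, so
    \<open>div\<close> undoes the multiplication.\<close>
  have "int p ^ h > 1" using assms(2,3) by (intro one_less_power) auto
  then have "poly (cyclotomic_poly \<delta>) (int p) \<noteq> 0" using eq by auto
  then show ?thesis unfolding D_quot_def eq by simp
qed

section \<open>Congruences and orders\<close>

context p_local
begin

lemma cring_p_integers: "cring (p_integers p :: 'a ring)"
proof (rule cringI)
  show "abelian_group (p_integers p :: 'a ring)"
  proof (rule abelian_groupI)
    fix x assume "x \<in> carrier (p_integers p :: 'a ring)"
    then show "\<exists>y\<in>carrier (p_integers p). y \<oplus>\<^bsub>p_integers p\<^esub> x = \<zero>\<^bsub>p_integers p\<^esub>"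
      unfolding carrier_p_integers by (intro bexI[of _ "- x"]) (simp_all add: p_integers_def)
  qed (unfold carrier_p_integers, simp_all add: p_integers_def add.assoc add.commute)
  show "comm_monoid (p_integers p :: 'a ring)"
    by (rule comm_monoidI; (unfold carrier_p_integers)?; simp add: p_integers_def mult.assoc mult.commute)
qed (simp add: p_integers_def distrib_right)

lemma R_power_int: "x \<in> R \<Longrightarrow> 1 / x \<in> R \<Longrightarrow> x powi k \<in> R"
  by (simp add: power_int_def inverse_eq_divide)

end

context good_prime_ideal
begin

lemma ideal_M: "ideal M (p_integers p)"
proof (rule idealI)
  show "ring (p_integers p :: 'a ring)" using cring_p_integers by (rule cring.axioms(1))
  interpret cring "p_integers p :: 'a ring" by (rule cring_p_integers)
  show "subgroup M (add_monoid (p_integers p))"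
  proof (rule add.subgroupI)
    show "M \<subseteq> carrier (p_integers p)" using M_subset by (simp add: carrier_p_integers)
    show "M \<noteq> {}" using M_0 by blast
    show "x \<oplus>\<^bsub>p_integers p\<^esub> y \<in> M" if "x \<in> M" "y \<in> M" for x y
      using M_add[OF that] by (simp add: p_integers_def)
    show "\<ominus>\<^bsub>p_integers p\<^esub> x \<in> M" if x: "x \<in> M" for x
    proof -
      have "x \<in> R" "- x \<in> R" using x M_subset by auto
      then have "\<ominus>\<^bsub>p_integers p\<^esub> x = - x"
        by (intro minus_equality) (simp_all add: carrier_p_integers, simp add: p_integers_def)
      then show ?thesis using M_uminus[OF x] by simp
    qed
  qed
  show "x \<otimes>\<^bsub>p_integers p\<^esub> a \<in> M" "a \<otimes>\<^bsub>p_integers p\<^esub> x \<in> M"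
    if "a \<in> M" "x \<in> carrier (p_integers p)" for a x
    using M_mult_left[of x a] M_mult_right[of a x] that unfolding carrier_p_integers
    by (simp_all add: p_integers_def)
qed

text \<open>The ideal generated by \<open>P\<close> is \<open>M\<close>: an element
  \<open>a / m\<close> of \<open>M\<close> is the multiple of \<open>a\<close> by the p-integral
  \<open>1 / m\<close>.\<close>

lemma p_cong_prime_iff: "p_cong p P x y \<longleftrightarrow> x \<in> R \<and> y \<in> R \<and> x - y \<in> M"
proof -
  interpret cring "p_integers p :: 'a ring" by (rule cring_p_integers)
  have P: "P \<subseteq> carrier (p_integers p)"
    using P_algebraic_int R_algebraic_int by (auto simp: carrier_p_integers)
  have "Idl\<^bsub>p_integers p\<^esub> P = M"
  proof
    show "Idl\<^bsub>p_integers p\<^esub> P \<subseteq> M" using P_subset_M by (intro genideal_minimal ideal_M subsetI)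
    show "M \<subseteq> Idl\<^bsub>p_integers p\<^esub> P"
    proof
      fix x assume "x \<in> M"
      then obtain a m where am: "x = a / of_int m" "a \<in> P" "\<not> int p dvd m" by (rule M_E)
      have "a \<in> Idl\<^bsub>p_integers p\<^esub> P" using genideal_self[OF P] am(2) by blast
      moreover have "(1 / of_int m :: 'a) \<in> carrier (p_integers p)"
        using R_inverse_int[OF am(3)] by (simp add: carrier_p_integers)
      ultimately have "1 / of_int m \<otimes>\<^bsub>p_integers p\<^esub> a \<in> Idl\<^bsub>p_integers p\<^esub> P"
        by (intro ideal.I_l_closed[OF genideal_ideal[OF P]])
      then show "x \<in> Idl\<^bsub>p_integers p\<^esub> P" using am(1) by (simp add: p_integers_def)
    qed
  qed
  then show ?thesis by (simp add: p_cong_def carrier_p_integers)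
qed

lemma p_cong_pD:
  assumes "p_cong p {of_nat p} x y"
  shows "p_cong p P x y"
proof -
  interpret cring "p_integers p :: 'a ring" by (rule cring_p_integers)
  have "Idl\<^bsub>p_integers p\<^esub> {of_nat p} \<subseteq> M"
    using P_subset_M[OF p_in_P] by (intro genideal_minimal ideal_M) simp
  then show ?thesis using assms unfolding p_cong_prime_iff by (auto simp: p_cong_def carrier_p_integers)
qed

lemma p_cong_pI:
  assumes "x \<in> R" "y \<in> R" "x - y \<in> pR"
  shows "p_cong p {of_nat p} x y"
proof -
  interpret cring "p_integers p :: 'a ring" by (rule cring_p_integers)
  have p: "{of_nat p} \<subseteq> carrier (p_integers p :: 'a ring)" by (simp add: carrier_p_integers)
  from assms(3) obtain z where z: "x - y = of_nat p * z" "z \<in> R" unfolding pR_def by (rule imageE)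
  have "(of_nat p :: 'a) \<in> Idl\<^bsub>p_integers p\<^esub> {of_nat p}" using genideal_self[OF p] by blast
  then have "of_nat p \<otimes>\<^bsub>p_integers p\<^esub> z \<in> Idl\<^bsub>p_integers p\<^esub> {of_nat p}"
    using z(2) by (intro ideal.I_r_closed[OF genideal_ideal[OF p]]) (simp_all add: carrier_p_integers)
  then have "x - y \<in> Idl\<^bsub>p_integers p\<^esub> {of_nat p}" using z(1) by (simp add: p_integers_def)
  then show ?thesis using assms(1,2) by (simp add: p_cong_def carrier_p_integers)
qed

lemma M_power_int_diff:
  assumes "x \<in> R" "1 / x \<in> R" "y \<in> R" "1 / y \<in> R" "x \<noteq> 0" "y \<noteq> 0" "x - y \<in> M"
  shows "x powi k - y powi k \<in> M"
proof (cases "k \<ge> 0")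
  case True
  then show ?thesis using M_power_diff[OF assms(7,1,3)] by (simp add: power_int_def)
next
  case False
  \<comment> \<open>For negative exponents the congruence is inverted, at the cost of a factor that
    is a unit.\<close>
  have "- (x - y) * (1 / x * (1 / y)) \<in> M" using assms by (intro M_mult_right M_uminus R_mult)
  moreover have "- (x - y) * (1 / x * (1 / y)) = 1 / x - 1 / y" using assms by (simp add: field_simps)
  ultimately have "1 / x - 1 / y \<in> M" by simp
  from M_power_diff[OF this assms(2,4)] False show ?thesis
    by (simp add: power_int_def inverse_eq_divide power_one_over)
qed

lemma M_prod_diff:
  assumes "finite I" "\<And>i. i \<in> I \<Longrightarrow> f i \<in> R \<and> g i \<in> R \<and> f i - g i \<in> M"
  shows "prod f I - prod g I \<in> M"
  using assms
proof (induction I rule: finite_induct)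
  case (insert i I)
  have "prod f (insert i I) - prod g (insert i I) = (f i - g i) * prod f I + g i * (prod f I - prod g I)"
    using insert.hyps by (simp add: algebra_simps)
  moreover have "(f i - g i) * prod f I \<in> M" using insert.prems by (intro M_mult_right R_prod) auto
  moreover have "g i * (prod f I - prod g I) \<in> M"
    using insert.prems insert.IH by (intro M_mult_left) auto
  ultimately show ?case by (simp only: M_add)
qed simp

text \<open>Two powers of \<eta> share a code, and the smaller one is cancelled because \<eta> is a
  unit. So the \<open>LEAST\<close> in \<open>order_mod_p\<close> and in
  \<open>order_mod_prime_roots\<close> is taken over a nonempty set.\<close>

lemma eta_power_cong_one: "\<exists>k\<ge>1. \<eta> ^ k - 1 \<in> pR"
proof -
  obtain r :: "'a \<Rightarrow> nat \<Rightarrow> int" where r: "finite (r ` R)"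
      "\<And>x y. x \<in> R \<Longrightarrow> y \<in> R \<Longrightarrow> r x = r y \<Longrightarrow> x - y \<in> pR"
    using finite_residues by blast
  have "finite ((\<lambda>i. r (\<eta> ^ i)) ` UNIV)"
    by (rule finite_subset[OF _ r(1)]) (use eta_R(1) in auto)
  then have "\<not> inj (\<lambda>i. r (\<eta> ^ i))" using finite_imageD infinite_UNIV_nat by blast
  then obtain i j where "i \<noteq> j" "r (\<eta> ^ i) = r (\<eta> ^ j)" by (auto simp: inj_def)
  then obtain i j where ij: "i < j" "r (\<eta> ^ j) = r (\<eta> ^ i)" by (metis linorder_neqE_nat)
  have "\<eta> ^ j - \<eta> ^ i \<in> pR" using ij(2) eta_R(1) by (intro r) auto
  then have "(\<eta> ^ j - \<eta> ^ i) * (1 / \<eta>) ^ i \<in> pR" using eta_R(2) by (intro pR_mult_right) auto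
  moreover have "(\<eta> ^ j - \<eta> ^ i) * (1 / \<eta>) ^ i = \<eta> ^ (j - i) - 1"
    using ij(1) eta_nz by (simp add: field_simps power_add[symmetric])
  ultimately show ?thesis using ij(1) by (intro exI[of _ "j - i"]) simp
qed

text \<open>The roots of unity form a group, so dividing \<open>N\<close> by \<open>k\<close> with
  remainder \<open>r\<close> turns the two congruences into one for \<open>\<eta> ^ r\<close>, and
  minimality of \<open>k\<close> forces \<open>r = 0\<close>. Together with Fermat this yields a
  divisor of \<open>p ^ h - 1\<close>.\<close>

lemma order_mod_prime_roots_least:
  defines "k \<equiv> order_mod_prime_roots p P \<eta>"
  shows "k \<ge> 1" "\<exists>\<zeta>\<in>roots_of_unity. \<eta> ^ k - \<zeta> \<in> M"
    and "\<And>N \<zeta>. N \<ge> 1 \<Longrightarrow> \<zeta> \<in> roots_of_unity \<Longrightarrow> \<eta> ^ N - \<zeta> \<in> M \<Longrightarrow> k dvd N"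
proof -
  let ?S = "\<lambda>k. k \<ge> 1 \<and> (\<exists>\<zeta>\<in>roots_of_unity. p_cong p P (\<eta> ^ k) \<zeta>)"
  have S_iff: "?S N \<longleftrightarrow> N \<ge> 1 \<and> (\<exists>\<zeta>\<in>roots_of_unity. \<eta> ^ N - \<zeta> \<in> M)" for N
    using eta_R(1) R_root_of_unity by (auto simp: p_cong_prime_iff)
  obtain i where "i \<ge> 1" "\<eta> ^ i - 1 \<in> pR" using eta_power_cong_one by blast
  then have "?S i" unfolding S_iff using pR_subset_M one_root_of_unity by blast
  then have k: "?S k" unfolding k_def order_mod_prime_roots_def by (rule LeastI)
  then show "k \<ge> 1" "\<exists>\<zeta>\<in>roots_of_unity. \<eta> ^ k - \<zeta> \<in> M" unfolding S_iff by blast+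
  from k obtain \<xi> where \<xi>: "\<xi> \<in> roots_of_unity" "\<eta> ^ k - \<xi> \<in> M" unfolding S_iff by blast
  fix N \<zeta> assume N: "N \<ge> 1" "\<zeta> \<in> roots_of_unity" "\<eta> ^ N - \<zeta> \<in> M"
  define q r where "q = N div k" and "r = N mod k"
  have "(\<eta> ^ k) ^ q - \<xi> ^ q \<in> M" using \<xi> eta_R(1) R_root_of_unity by (intro M_power_diff) auto
  then have "((\<eta> ^ k) ^ q - \<xi> ^ q) * \<eta> ^ r \<in> M" using eta_R(1) by (intro M_mult_right) auto
  from M_diff[OF N(3) this] have "\<xi> ^ q * \<eta> ^ r - \<zeta> \<in> M"
    by (simp add: algebra_simps power_mult[symmetric] power_add[symmetric] q_def r_def)
  moreover have inv: "1 / \<xi> \<in> roots_of_unity" using \<xi>(1) by (rule roots_of_unity_inverse)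
  ultimately have "(\<xi> ^ q * \<eta> ^ r - \<zeta>) * (1 / \<xi>) ^ q \<in> M"
    using R_root_of_unity by (intro M_mult_right) auto
  moreover have "(\<xi> ^ q * \<eta> ^ r - \<zeta>) * (1 / \<xi>) ^ q = \<eta> ^ r - \<zeta> * (1 / \<xi>) powi int q"
    using roots_of_unity_nz[OF \<xi>(1)] by (simp add: field_simps)
  ultimately have "\<eta> ^ r - \<zeta> * (1 / \<xi>) powi int q \<in> M" by simp
  moreover have "\<zeta> * (1 / \<xi>) powi int q \<in> roots_of_unity"
    using N(2) inv by (intro roots_of_unity_mult roots_of_unity_power_int)
  ultimately have "?S r" if "r \<ge> 1" unfolding S_iff using that by blast
  moreover have "r < k" using \<open>k \<ge> 1\<close> by (simp add: r_def)
  ultimately have "r = 0" using not_less_Least[of r ?S] unfolding k_def order_mod_prime_roots_def by fastforce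
  then show "k dvd N" unfolding r_def by (rule mod_0_imp_dvd)
qed

end

section \<open>Frobenius orbits of \<eta> and the final contradiction\<close>

context good_prime_ideal
begin

lemma R_unit_Gal:
  assumes "\<sigma> \<in> Gal"
  shows "\<sigma> \<eta> \<in> R" "1 / \<sigma> \<eta> \<in> R" "\<sigma> \<eta> \<noteq> 0"
proof -
  have "\<sigma> (1 / \<eta>) = 1 / \<sigma> \<eta>" using assms by (simp add: Gal_simps(2,10)[of \<sigma>])
  then show "\<sigma> \<eta> \<in> R" "1 / \<sigma> \<eta> \<in> R" using R_Gal[OF assms eta_R(1)] R_Gal[OF assms eta_R(2)] by simp_all
  show "\<sigma> \<eta> \<noteq> 0" using assms eta_nz by (simp add: Gal_simps(8))
qed

text \<open>If \<open>\<sigma> ^^ i\<close> and \<open>\<sigma> ^^ j\<close> agree at \<eta> for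
  \<open>i < j\<close>, then \<open>\<sigma> ^^ (j - i)\<close> is the identity, so every residue is
  a root of \<open>X ^ (p ^ (j - i)) - X\<close> and the residue degree is at most
  \<open>j - i\<close>.\<close>

lemma inj_on_frobenius_orbit:
  assumes \<sigma>: "\<sigma> \<in> Gal" "\<And>x. x \<in> R \<Longrightarrow> \<sigma> x - x ^ p \<in> M"
  shows "inj_on (\<lambda>i. (\<sigma> ^^ i) \<eta>) {..<residue_degree P}"
proof -
  have False if ij: "i < j" "j < residue_degree P" "(\<sigma> ^^ i) \<eta> = (\<sigma> ^^ j) \<eta>" for i j
  proof -
    define m where "m = j - i"
    have m: "m > 0" "m < residue_degree P" "j = i + m" using ij by (simp_all add: m_def)
    have eq: "\<sigma> ^^ i = \<sigma> ^^ j" using \<sigma>(1) ij(3) by (intro Gal_eqI) simp_all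
    have fixed: "(\<sigma> ^^ m) x = x" for x
    proof -
      have "(\<sigma> ^^ i) ((\<sigma> ^^ m) x) = (\<sigma> ^^ i) x" using fun_cong[OF eq, of x] m(3) by (simp add: funpow_add)
      then show ?thesis using Gal_simps(11)[OF Gal_funpow[OF \<sigma>(1)]] by blast
    qed
    have "x ^ (p ^ m) - x \<in> P" if x: "algebraic_int x" for x
    proof (rule M_algebraic_int)
      have "x - x ^ (p ^ m) \<in> M" using frobenius_funpow[OF \<sigma> R_algebraic_int[OF x], of m] fixed by simp
      from M_uminus[OF this] show "x ^ (p ^ m) - x \<in> M" by simp
      show "algebraic_int (x ^ (p ^ m) - x)"
        using algebraic_int_add[OF algebraic_int_power[OF x], of "- x"] x by simp
    qed
    then have "residue_degree P \<le> m" using m(1) by (intro residue_degree_le)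
    then show False using m(2) by simp
  qed
  then show ?thesis by (intro inj_onI) (metis lessThan_iff linorder_neqE_nat)
qed

lemma frobenius_polynomial_cong:
  assumes \<sigma>: "\<sigma> \<in> Gal" "\<And>x. x \<in> R \<Longrightarrow> \<sigma> x - x ^ p \<in> M"
    and \<zeta>: "\<zeta> \<in> roots_of_unity" "\<eta> ^ k - \<zeta> \<in> M"
    and A: "degree A < h" "int k dvd poly A (int p)"
  obtains \<xi> where "\<xi> \<in> roots_of_unity" "(\<Prod>i<h. (\<sigma> ^^ i) \<eta> powi coeff A i) - \<xi> \<in> M"
proof -
  from A(2) obtain t where t: "poly A (int p) = int k * t" by (elim dvdE)
  \<comment> \<open>Coefficients of \<open>A\<close> may be negative, so the powers of \<eta> have
    to be units of \<open>R\<close>.\<close>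
  have eta_pow: "\<eta> ^ l \<in> R" "1 / \<eta> ^ l \<in> R" "\<eta> ^ l \<noteq> 0" for l
    using eta_R eta_nz R_power[OF eta_R(2), of l] by (simp_all add: power_one_over)
  have "poly A (int p) = (\<Sum>i<h. coeff A i * int p ^ i)"
    unfolding poly_altdef using A(1) by (intro sum.mono_neutral_left) (auto simp: coeff_eq_0)
  then have "\<eta> powi poly A (int p) = (\<Prod>i<h. \<eta> powi (coeff A i * int p ^ i))"
    using eta_nz by (simp add: power_int_sum)
  also have "\<dots> = (\<Prod>i<h. (\<eta> ^ (p ^ i)) powi coeff A i)"
  proof (intro prod.cong refl)
    fix i
    have "\<eta> powi (int (p ^ i) * coeff A i) = (\<eta> powi int (p ^ i)) powi coeff A i" by (rule power_int_mult)
    then show "\<eta> powi (coeff A i * int p ^ i) = (\<eta> ^ (p ^ i)) powi coeff A i"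
      by (simp only: power_int_of_nat) (simp add: mult.commute)
  qed
  finally have eta: "(\<Prod>i<h. (\<eta> ^ (p ^ i)) powi coeff A i) = (\<eta> ^ k) powi t"
    unfolding t by (simp add: power_int_mult)
  have "(\<Prod>i<h. (\<sigma> ^^ i) \<eta> powi coeff A i) - (\<Prod>i<h. (\<eta> ^ (p ^ i)) powi coeff A i) \<in> M"
    using R_unit_Gal[OF Gal_funpow[OF \<sigma>(1)]] eta_pow frobenius_funpow[OF \<sigma> eta_R(1)] eta_nz
    by (intro M_prod_diff conjI R_power_int M_power_int_diff) simp_all
  moreover have "(\<eta> ^ k) powi t - \<zeta> powi t \<in> M"
    using \<zeta> eta_pow R_root_of_unity roots_of_unity_inverse[OF \<zeta>(1)] roots_of_unity_nz eta_nz
    by (intro M_power_int_diff) simp_all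
  ultimately have "((\<Prod>i<h. (\<sigma> ^^ i) \<eta> powi coeff A i) - (\<eta> ^ k) powi t) + ((\<eta> ^ k) powi t - \<zeta> powi t) \<in> M"
    unfolding eta by (rule M_add)
  then show ?thesis using that[OF roots_of_unity_power_int[OF \<zeta>(1)]] by simp
qed

end

context conjugates_independent
begin

text \<open>Raising to a power \<open>m\<close> that kills the root of unity gives a multiplicative
  relation among conjugates, whose exponents, \<open>m\<close> times the coefficients of
  \<open>A\<close>, would all vanish.\<close>

lemma orbit_power_prod_not_root_of_unity:
  assumes \<sigma>: "\<sigma> \<in> Gal" "inj_on (\<lambda>i. (\<sigma> ^^ i) \<eta>) {..<h}" and A: "A \<noteq> 0" "degree A < h"
  shows "(\<Prod>i<h. (\<sigma> ^^ i) \<eta> powi coeff A i) \<notin> roots_of_unity"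
proof
  let ?f = "\<lambda>i. (\<sigma> ^^ i) \<eta>"
  assume "(\<Prod>i<h. ?f i powi coeff A i) \<in> roots_of_unity"
  then obtain m where m: "m > 0" "(\<Prod>i<h. ?f i powi coeff A i) ^ m = 1" by (auto simp: roots_of_unity_def)
  \<comment> \<open>Exponents are carried from indices to conjugates, as injectivity permits, and
    extended by 0 outside the orbit.\<close>
  define e where "e c = (if c \<in> ?f ` {..<h} then int m * coeff A (inv_into {..<h} ?f c) else 0)" for c
  have e: "e (?f i) = int m * coeff A i" if "i < h" for i
    using that inv_into_f_f[OF \<sigma>(2), of i] by (simp add: e_def)
  have sub: "?f ` {..<h} \<subseteq> conjugates" using \<sigma>(1) by (auto simp: conjugates_def)
  have "(\<Prod>c\<in>conjugates. c powi e c) = (\<Prod>c\<in>?f ` {..<h}. c powi e c)"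
    using finite_conjugates sub by (intro prod.mono_neutral_right) (auto simp: e_def)
  also have "\<dots> = (\<Prod>i<h. ?f i powi (coeff A i * int m))"
    using e by (simp add: prod.reindex[OF \<sigma>(2)] mult.commute)
  also have "\<dots> = (\<Prod>i<h. ?f i powi coeff A i) ^ m"
    by (simp only: power_int_mult power_int_of_nat prod_power_distrib)
  finally have "(\<Prod>c\<in>conjugates. c powi e c) = 1" using m(2) by simp
  then have "e c = 0" if "c \<in> conjugates" for c
    using conjugates_mult_independent that unfolding mult_independent_def by blast
  then have "coeff A i = 0" if "i < h" for i using that sub e[OF that] m(1) by (auto simp: image_subset_iff)
  then show False using A by (metis leading_coeff_0_iff)
qed

lemma eventually_orders_not_dvd:
  assumes h: "h > 0"
  shows "\<forall>\<^sub>F p in sequentially. Factorial_Ring.prime p \<longrightarrow>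
    (\<forall>P\<in>primes_above p. residue_degree P = h \<longrightarrow>
       order_mod_prime_roots p P \<eta> dvd p ^ h - 1 \<and>
       (\<forall>\<delta>. \<delta> dvd h \<longrightarrow>
          \<not> int (order_mod_prime_roots p P \<eta>) dvd D_quot h \<delta> p \<and>
          \<not> int (order_mod_prime p P \<eta>) dvd D_quot h \<delta> p \<and>
          \<not> int (order_mod_p p \<eta>) dvd D_quot h \<delta> p))"
proof -
  have "\<forall>\<delta>. \<exists>A::int poly. \<delta> dvd h \<longrightarrow> A * cyclotomic_poly \<delta> = monom 1 h - 1 \<and> A \<noteq> 0 \<and> degree A < h"
    using cyclotomic_cofactor[OF h] by metis
  then obtain A :: "nat \<Rightarrow> int poly" where A: "\<And>\<delta>. \<delta> dvd h \<Longrightarrow> A \<delta> * cyclotomic_poly \<delta> = monom 1 h - 1"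
      "\<And>\<delta>. \<delta> dvd h \<Longrightarrow> A \<delta> \<noteq> 0" "\<And>\<delta>. \<delta> dvd h \<Longrightarrow> degree (A \<delta>) < h"
    by metis
  let ?\<theta> = "\<lambda>(\<sigma>, \<delta>, \<xi>). (\<Prod>i<h. (\<sigma> ^^ i) \<eta> powi coeff (A \<delta>) i) - \<xi>"
  \<comment> \<open>All differences that can occur at any prime, with \<sigma>, \<delta> and \<xi>
    ranging over finite sets independent of \<open>p\<close>; 0 is removed so that
    \<open>1 / \<theta>\<close> is a genuine inverse.\<close>
  define \<Theta> where "\<Theta> = ?\<theta> ` (Gal \<times> {\<delta>. \<delta> dvd h} \<times> (roots_of_unity :: 'a set)) - {0}"
  have "finite \<Theta>" unfolding \<Theta>_def using finite_Gal finite_roots_of_unity h by simp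
  then have ev: "\<forall>\<^sub>F p in sequentially. \<forall>\<theta>\<in>\<Theta>. Factorial_Ring.prime p \<longrightarrow> 1 / \<theta> \<in> p_local.R p"
    using eventually_p_integral by (intro eventually_ball_finite) auto
  show ?thesis using ev eventually_good_prime
  proof eventually_elim
    case (elim p)
    show ?case
    proof (intro impI ballI)
      fix P :: "'a set"
      assume p: "Factorial_Ring.prime p" and P: "P \<in> primes_above p" and deg: "residue_degree P = h"
      interpret good_prime \<eta> p using elim(2) p by blast
      interpret good_prime_ideal \<eta> p P by unfold_locales (rule P)
      have p2: "p \<ge> 2" using p by (rule prime_ge_2_nat)
      obtain \<sigma> where \<sigma>: "\<sigma> \<in> Gal" "\<And>x. x \<in> R \<Longrightarrow> \<sigma> x - x ^ p \<in> M" using frobenius_exists by blast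
      have inj: "inj_on (\<lambda>i. (\<sigma> ^^ i) \<eta>) {..<h}" using inj_on_frobenius_orbit[OF \<sigma>] deg by simp
      \<comment> \<open>Stated for any exponent at which \<eta> meets a root of unity, since all
        three orders are of this kind: 1 is a root of unity, and a congruence modulo
        \<open>p\<close> holds modulo \<open>P\<close>.\<close>
      have not_dvd: "\<not> int k dvd D_quot h \<delta> p"
        if \<delta>: "\<delta> dvd h" and k: "\<zeta> \<in> roots_of_unity" "\<eta> ^ k - \<zeta> \<in> M" for k \<zeta> \<delta>
      proof
        assume "int k dvd D_quot h \<delta> p"
        then have "int k dvd poly (A \<delta>) (int p)" using D_quot_eq[OF A(1)[OF \<delta>] h p2] by simp
        from frobenius_polynomial_cong[OF \<sigma> k A(3)[OF \<delta>] this]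
        obtain \<xi> where \<xi>: "\<xi> \<in> roots_of_unity" "(\<Prod>i<h. (\<sigma> ^^ i) \<eta> powi coeff (A \<delta>) i) - \<xi> \<in> M" .
        define \<theta> where "\<theta> = ?\<theta> (\<sigma>, \<delta>, \<xi>)"
        have "\<theta> \<noteq> 0"
          using orbit_power_prod_not_root_of_unity[OF \<sigma>(1) inj A(2)[OF \<delta>] A(3)[OF \<delta>]] \<xi>(1)
          by (auto simp: \<theta>_def)
        moreover from this have "\<theta> \<in> \<Theta>" unfolding \<Theta>_def \<theta>_def using \<sigma>(1) \<delta> \<xi>(1) by blast
        then have "1 / \<theta> \<in> R" using elim(1) p by blast
        moreover have "\<theta> \<in> M" using \<xi>(2) by (simp add: \<theta>_def)
        ultimately have "1 \<in> M" using M_mult_right[of \<theta> "1 / \<theta>"] by simp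
        then show False using one_notin_M by simp
      qed
      have N: "p ^ h - 1 \<ge> 1" using one_less_power[of p h] p2 h by simp
      have fermat: "\<eta> ^ (p ^ h - 1) - 1 \<in> M" using eta_fermat deg by simp
      have "p_cong p P (\<eta> ^ (p ^ h - 1)) 1" using fermat eta_R(1) by (simp add: p_cong_prime_iff)
      then have "p_cong p P (\<eta> ^ order_mod_prime p P \<eta>) 1"
        unfolding order_mod_prime_def using LeastI[of "\<lambda>k. k \<ge> 1 \<and> p_cong p P (\<eta> ^ k) 1"] N by blast
      then have o1: "\<eta> ^ order_mod_prime p P \<eta> - 1 \<in> M" by (simp add: p_cong_prime_iff)
      obtain k where "k \<ge> 1" "\<eta> ^ k - 1 \<in> pR" using eta_power_cong_one by blast
      then have "k \<ge> 1 \<and> p_cong p {of_nat p} (\<eta> ^ k) 1" using eta_R(1) by (simp add: p_cong_pI)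
      then have "p_cong p {of_nat p} (\<eta> ^ order_mod_p p \<eta>) 1"
        unfolding order_mod_p_def by (rule LeastI2) blast
      then have o2: "\<eta> ^ order_mod_p p \<eta> - 1 \<in> M" using p_cong_pD by (simp add: p_cong_prime_iff)
      obtain \<zeta> where o3: "\<zeta> \<in> roots_of_unity" "\<eta> ^ order_mod_prime_roots p P \<eta> - \<zeta> \<in> M"
        using order_mod_prime_roots_least(2) by blast
      show "order_mod_prime_roots p P \<eta> dvd p ^ h - 1 \<and>
       (\<forall>\<delta>. \<delta> dvd h \<longrightarrow>
          \<not> int (order_mod_prime_roots p P \<eta>) dvd D_quot h \<delta> p \<and>
          \<not> int (order_mod_prime p P \<eta>) dvd D_quot h \<delta> p \<and>
          \<not> int (order_mod_p p \<eta>) dvd D_quot h \<delta> p)"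
        using order_mod_prime_roots_least(3)[OF N one_root_of_unity fermat]
          not_dvd[OF _ o3] not_dvd[OF _ one_root_of_unity o1] not_dvd[OF _ one_root_of_unity o2]
        by blast
    qed
  qed
qed

end

theorem theorem2p1:
  fixes \<eta> :: "'a::field_char_0" and n h :: nat
  assumes "finite_galois_over_rat TYPE('a)"
    and "degree_over_rat TYPE('a) = n"
    and "h dvd n"
    and "\<exists>H. subgroup H (galois_group :: ('a \<Rightarrow> 'a) monoid) \<and>
           cyclic_group ((galois_group :: ('a \<Rightarrow> 'a) monoid)\<lparr>carrier := H\<rparr>) \<and> card H = h"
    and "\<eta> \<noteq> 0"
    and "has_mult_rank (galois_module \<eta>) n"
  shows "\<forall>\<^sub>F p in sequentially.
           Factorial_Ring.prime p \<and> unramified TYPE('a) p \<and> prime_to p \<eta> \<and>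
           has_residue_degree TYPE('a) p h \<longrightarrow>
           (\<forall>P \<in> primes_above p.
              order_mod_prime_roots p P \<eta> dvd p ^ h - 1 \<and>
              (\<forall>\<delta>. \<delta> dvd h \<longrightarrow>
                 \<not> int (order_mod_prime_roots p P \<eta>) dvd D_quot h \<delta> p \<and>
                 \<not> int (order_mod_prime p P \<eta>) dvd D_quot h \<delta> p \<and>
                 \<not> int (order_mod_p p \<eta>) dvd D_quot h \<delta> p))"
proof (cases "cring (ring_of_integers :: 'a ring)")
  case True
  interpret conjugates_independent \<eta> by (rule conjugates_independent.intro) (use assms True in simp_all)
  have "h > 0" using assms(2,3) degree_over_rat_pos by (metis dvd_pos_nat)
  from eventually_orders_not_dvd[OF this] show ?thesis
    by eventually_elim (simp add: has_residue_degree_def)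
next
  case False
  \<comment> \<open>\<^const>\<open>primeideal\<close> includes the ring axioms, so the closure of the algebraic integers under
    ring operations may be assumed.\<close>
  then have "primes_above p = ({} :: 'a set set)" for p
    by (auto simp: primes_above_def dest: primeideal.axioms(2))
  then show ?thesis by simp
qed

end
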